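(* Consider the class of groups $G(A)$ generated by invertible automata $A$ with $3$ states over a $2$-letter alphabet. The only free non-abelian group in this class, up to isomorphism, is the free group of rank $3$, and it is generated by the Aleshin–Vorobets automaton (automaton number $2240$), i.e. the automaton with states $a=\sigma(b,c)$, $b=\sigma(c,b)$, $c=(a,a)$. Moreover, the isomorphism class of this automaton group coincides with its equivalence class under symmetry: an invertible $3$-state automaton $A$ over a $2$-letter alphabet satisfies $G(A)\cong G(A_{2240})$ if and only if $A$ is symmetric to the automaton $A_{2240}$ number $2240$.
   Context: A finite invertible automaton is a quadruple $A=(Q,X,\tau,\rho)$ where $Q$ is a finite set of states, $X$ is a finite alphabet, $\tau:Q\times X\to Q$ and $\rho:Q\times X\to X$ are maps such that for each $q\in Q$ the map $\rho_q:X\to X$, $\rho_q(x)=\rho(q,x)$, is a permutation of $X$. Each state $q$ defines an automorphism, also denoted $q$, of the rooted tree $X^*$ of finite words over $X$, recursively by $q(\emptyset)=\emptyset$ and $q(xw)=\rho_q(x)\,\tau(q,x)(w)$ for $x\in X$, $w\in X^*$. The automaton group $G(A)$ is the subgroup of $\mathrm{Aut}(X^* )$ generated by the automorphisms defined by the states. Here $|Q|=3$ and $|X|=2$; distinct states are allowed to define the same automorphism. Notation: $X=\{0,1\}$, $Q=\{a,b,c\}$; $\sigma$ denotes the transposition of $0$ and $1$; $q=\sigma(r,s)$ (respectively $q=(r,s)$) means $\rho_q=\sigma$ (respectively $\rho_q$ is the identity), $\tau(q,0)=r$, $\tau(q,1)=s$. Two such automata are symmetric if one can be obtained from the other by a composition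 of operations of the following types: permuting (renaming) the states, permuting the letters of the alphabet (i.e. renaming the letters simultaneously in inputs and outputs), and passing to the inverse automaton. The inverse automaton of $A=(Q,X,\tau,\rho)$ is the automaton with states $q^{-1}$, $q\in Q$, where $\rho_{q^{-1}}=(\rho_q)^{-1}$ and $\tau(q^{-1},\rho_q(x))=\tau(q,x)^{-1}$; its states define the inverses of the automorphisms defined by the states of $A$. *)

theory Defs
  imports "HOL-Algebra.Algebra"
begin

section \<open>Automata and their groups\<close>

record ('q, 'x) automaton =
  transition :: "'q \<Rightarrow> 'x \<Rightarrow> 'q"
  out :: "'q \<Rightarrow> 'x \<Rightarrow> 'x"

definition invertible_automaton :: "('q, 'x) automaton \<Rightarrow> bool" where
  "invertible_automaton A \<longleftrightarrow> (\<forall>q. bij (out A q))"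

fun act :: "('q, 'x) automaton \<Rightarrow> 'q \<Rightarrow> 'x list \<Rightarrow> 'x list" where
  "act A q [] = []"
| "act A q (x # w) = out A q x # act A (transition A q x) w"

text \<open>The root of the tree of words is \<open>[]\<close> and the children of \<open>v\<close> are the words \<open>v @ [x]\<close>.\<close>

definition tree_Aut :: "('x list \<Rightarrow> 'x list) monoid" where
  "tree_Aut = \<lparr>
     carrier = {f. bij f \<and> f [] = [] \<and>
                   (\<forall>v w. (\<exists>x. w = v @ [x]) \<longleftrightarrow> (\<exists>x. f w = f v @ [x]))},
     monoid.mult = (\<circ>),
     one = id\<rparr>"

definition automaton_group :: "('q, 'x) automaton \<Rightarrow> ('x list \<Rightarrow> 'x list) monoid" where
  "automaton_group A = subgroup_generated tree_Aut (range (act A))"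

section \<open>Symmetry of automata\<close>

text \<open>The state \<open>q\<close> of the inverse automaton stands for the formal inverse of \<open>q\<close>.\<close>

definition inverse_automaton :: "('q, 'x) automaton \<Rightarrow> ('q, 'x) automaton" where
  "inverse_automaton A = \<lparr>
     transition = (\<lambda>q y. transition A q (inv_into UNIV (out A q) y)),
     out = (\<lambda>q. inv_into UNIV (out A q))\<rparr>"

definition rename_states :: "('q \<Rightarrow> 'r) \<Rightarrow> ('q, 'x) automaton \<Rightarrow> ('r, 'x) automaton" where
  "rename_states f A = \<lparr>
     transition = (\<lambda>r x. f (transition A (inv_into UNIV f r) x)),
     out = (\<lambda>r. out A (inv_into UNIV f r))\<rparr>"

definition rename_letters :: "('x \<Rightarrow> 'y) \<Rightarrow> ('q, 'x) automaton \<Rightarrow> ('q, 'y) automaton" where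
  "rename_letters g A = \<lparr>
     transition = (\<lambda>q y. transition A q (inv_into UNIV g y)),
     out = (\<lambda>q y. g (out A q (inv_into UNIV g y)))\<rparr>"

inductive symmetry_step :: "('q, 'x) automaton \<Rightarrow> ('q, 'x) automaton \<Rightarrow> bool" where
  states: "bij f \<Longrightarrow> symmetry_step A (rename_states f A)"
| letters: "bij g \<Longrightarrow> symmetry_step A (rename_letters g A)"
| inverse: "symmetry_step A (inverse_automaton A)"

text \<open>
  The two automata may have different types of states and of letters; the initial renaming
  moves \<open>A\<close> to the types of \<open>B\<close>, where the operations can be composed freely.
\<close>

definition symmetric_automata :: "('q, 'x) automaton \<Rightarrow> ('r, 'y) automaton \<Rightarrow> bool" where
  "symmetric_automata A B \<longleftrightarrow>
     (\<exists>f g. bij f \<and> bij g \<and> symmetry_step\<^sup>*\<^sup>* (rename_states f (rename_letters g A)) B)"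

section \<open>The Aleshin--Vorobets automaton\<close>

datatype state = Sa | Sb | Sc

instance state :: finite
proof
  have "(UNIV :: state set) = {Sa, Sb, Sc}"
    using state.exhaust by blast
  then show "finite (UNIV :: state set)"
    by (metis finite.emptyI finite.insertI)
qed

text \<open>The letters 0 and 1 are \<open>False\<close> and \<open>True\<close>, so that \<open>Not\<close> is the transposition.\<close>

definition aleshin_vorobets :: "(state, bool) automaton" where
  "aleshin_vorobets = \<lparr>
     transition = (\<lambda>q x. case q of
         Sa \<Rightarrow> if x then Sc else Sb
       | Sb \<Rightarrow> if x then Sb else Sc
       | Sc \<Rightarrow> Sa),
     out = (\<lambda>q. case q of Sa \<Rightarrow> Not | Sb \<Rightarrow> Not | Sc \<Rightarrow> id)\<rparr>"

section \<open>Free groups\<close>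

text \<open>The letter \<open>(s, True)\<close> stands for \<open>s\<close>, and \<open>(s, False)\<close> for the inverse of \<open>s\<close>.\<close>

definition inv_letter :: "'a \<times> bool \<Rightarrow> 'a \<times> bool" where
  "inv_letter x = (fst x, \<not> snd x)"

definition reduced_word :: "('a \<times> bool) list \<Rightarrow> bool" where
  "reduced_word w \<longleftrightarrow> successively (\<lambda>x y. y \<noteq> inv_letter x) w"

fun reduced_cons :: "'a \<times> bool \<Rightarrow> ('a \<times> bool) list \<Rightarrow> ('a \<times> bool) list" where
  "reduced_cons x [] = [x]"
| "reduced_cons x (y # w) = (if y = inv_letter x then w else x # y # w)"

text \<open>The product of two reduced words is the reduced form of their concatenation.\<close>

definition free_group :: "'a set \<Rightarrow> ('a \<times> bool) list monoid" where
  "free_group S = \<lparr>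
     carrier = {w. reduced_word w \<and> fst ` set w \<subseteq> S},
     monoid.mult = (\<lambda>u v. foldr reduced_cons u v),
     one = []\<rparr>"

text \<open>
  A basis of \<open>G\<close> lies in the carrier of \<open>G\<close>, so it suffices to consider generating sets of
  the element type.
\<close>

definition is_free_group :: "('a, 'm) monoid_scheme \<Rightarrow> bool" where
  "is_free_group G \<longleftrightarrow> (\<exists>S :: 'a set. G \<cong> free_group S)"

section \<open>Basic facts\<close>

lemma invertible_aleshin_vorobets: "invertible_automaton aleshin_vorobets"
  unfolding invertible_automaton_def aleshin_vorobets_def
  by (auto split: state.split intro: involuntory_imp_bij)

lemma group_tree_Aut: "group (tree_Aut :: ('x list \<Rightarrow> 'x list) monoid)"
proof (rule groupI)
  fix f :: "'x list \<Rightarrow> 'x list"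
  assume f: "f \<in> carrier tree_Aut"
  then have b: "bij f" and r: "f [] = []"
    and c: "\<And>v w. (\<exists>x. w = v @ [x]) \<longleftrightarrow> (\<exists>x. f w = f v @ [x])"
    by (auto simp: tree_Aut_def)
  have "(\<exists>x. w = v @ [x]) \<longleftrightarrow> (\<exists>x. inv_into UNIV f w = inv_into UNIV f v @ [x])" for v w
    using c[of "inv_into UNIV f w" "inv_into UNIV f v"] b by (simp add: bij_is_surj surj_f_inv_f)
  moreover have "inv_into UNIV f [] = []"
    using b r by (metis bij_inv_eq_iff)
  ultimately have "inv_into UNIV f \<in> carrier tree_Aut"
    using b by (simp add: tree_Aut_def bij_imp_bij_inv)
  moreover have "inv_into UNIV f \<otimes>\<^bsub>tree_Aut\<^esub> f = \<one>\<^bsub>tree_Aut\<^esub>"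
    using b by (simp add: tree_Aut_def bij_is_inj)
  ultimately show "\<exists>g\<in>carrier tree_Aut. g \<otimes>\<^bsub>tree_Aut\<^esub> f = \<one>\<^bsub>tree_Aut\<^esub>"
    by blast
next
  fix f g :: "'x list \<Rightarrow> 'x list"
  assume f: "f \<in> carrier tree_Aut" and g: "g \<in> carrier tree_Aut"
  have "(\<exists>x. w = v @ [x]) \<longleftrightarrow> (\<exists>x. f (g w) = f (g v) @ [x])" for v w
  proof -
    have "(\<exists>x. w = v @ [x]) \<longleftrightarrow> (\<exists>x. g w = g v @ [x])"
      using g by (simp add: tree_Aut_def)
    also have "\<dots> \<longleftrightarrow> (\<exists>x. f (g w) = f (g v) @ [x])"
      using f by (simp add: tree_Aut_def)
    finally show ?thesis .
  qed
  with f g show "f \<otimes>\<^bsub>tree_Aut\<^esub> g \<in> carrier tree_Aut"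
    by (simp add: tree_Aut_def bij_comp)
qed (auto simp: tree_Aut_def)

lemma length_act [simp]: "length (act A q w) = length w"
  by (induction w arbitrary: q) auto

lemma act_append_singleton: "\<exists>p. \<forall>x. act A q (v @ [x]) = act A q v @ [out A p x]"
  by (induction v arbitrary: q) auto

lemma act_inverse_automaton:
  assumes "invertible_automaton A"
  shows "act (inverse_automaton A) q (act A q w) = w"
    and "act A q (act (inverse_automaton A) q w) = w"
proof -
  have b: "bij (out A p)" for p
    using assms by (simp add: invertible_automaton_def)
  show "act (inverse_automaton A) q (act A q w) = w"
    by (induction w arbitrary: q) (simp_all add: inverse_automaton_def b bij_is_inj)
  show "act A q (act (inverse_automaton A) q w) = w"
    by (induction w arbitrary: q)
      (simp_all add: inverse_automaton_def b bij_is_surj surj_f_inv_f)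
qed

lemma act_in_tree_Aut:
  assumes "invertible_automaton A"
  shows "act A q \<in> carrier tree_Aut"
proof -
  note act_inv = act_inverse_automaton[OF assms]
  have "bij (act A q)"
    by (rule o_bij[of "act (inverse_automaton A) q"]) (auto simp: fun_eq_iff act_inv)
  moreover have "(\<exists>x. w = v @ [x]) \<longleftrightarrow> (\<exists>x. act A q w = act A q v @ [x])" for v w
  proof
    show "\<exists>x. act A q w = act A q v @ [x]" if "\<exists>x. w = v @ [x]"
      using that act_append_singleton[of A q v] by auto
  next
    assume "\<exists>x. act A q w = act A q v @ [x]"
    then obtain x where "act A q w = act A q v @ [x]" ..
    then have "w = act (inverse_automaton A) q (act A q v @ [x])"
      by (metis act_inv(1))
    then show "\<exists>x. w = v @ [x]"
      using act_append_singleton[of "inverse_automaton A" q "act A q v"] by (auto simp: act_inv)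
  qed
  ultimately show ?thesis
    by (simp add: tree_Aut_def)
qed

lemma group_automaton_group: "group (automaton_group A)"
  unfolding automaton_group_def by (rule group.group_subgroup_generated[OF group_tree_Aut])

lemma inv_letter_inv_letter [simp]: "inv_letter (inv_letter x) = x"
  by (simp add: inv_letter_def)

lemma inv_letter_neq [simp]: "inv_letter x \<noteq> x" "x \<noteq> inv_letter x"
  by (auto simp: inv_letter_def prod_eq_iff)

lemma reduced_word_reduced_cons:
  "reduced_word w \<Longrightarrow> reduced_word (reduced_cons x w)"
  by (cases w) (auto simp: reduced_word_def successively_Cons)

lemma reduced_word_foldr: "reduced_word w \<Longrightarrow> reduced_word (foldr reduced_cons u w)"
  by (induction u) (auto intro: reduced_word_reduced_cons)

lemma reduced_cons_inv_letter:
  assumes "reduced_word w"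
  shows "reduced_cons x (reduced_cons (inv_letter x) w) = w"
proof (cases w)
  case (Cons y v)
  with assms show ?thesis
    by (cases v) (auto simp: reduced_word_def)
qed simp

lemma foldr_reduced_cons:
  assumes "reduced_word w"
  shows "foldr reduced_cons (reduced_cons x v) w = reduced_cons x (foldr reduced_cons v w)"
  by (cases v) (auto simp: reduced_cons_inv_letter reduced_word_foldr assms)

lemma foldr_foldr_reduced_cons:
  "reduced_word w \<Longrightarrow>
    foldr reduced_cons (foldr reduced_cons u v) w = foldr reduced_cons u (foldr reduced_cons v w)"
  by (induction u) (auto simp: foldr_reduced_cons)

lemma set_reduced_cons: "set (reduced_cons x w) \<subseteq> insert x (set w)"
  by (cases w) auto

lemma set_foldr_reduced_cons: "set (foldr reduced_cons u w) \<subseteq> set u \<union> set w"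
proof (induction u)
  case (Cons x u)
  then show ?case
    using set_reduced_cons[of x "foldr reduced_cons u w"] by auto
qed simp

lemma foldr_reduced_cons_Nil: "reduced_word u \<Longrightarrow> foldr reduced_cons u [] = u"
proof (induction u)
  case (Cons x u)
  then show ?case
    by (cases u) (auto simp: reduced_word_def)
qed simp

lemma foldr_reduced_cons_rev: "foldr reduced_cons (rev (map inv_letter u)) u = []"
  by (induction u) auto

lemma reduced_word_rev:
  assumes "reduced_word u"
  shows "reduced_word (rev (map inv_letter u))"
proof -
  have "inv_letter x \<noteq> inv_letter (inv_letter y)" if "y \<noteq> inv_letter x" for x y :: "'a \<times> bool"
    using that by auto
  with assms show ?thesis
    unfolding reduced_word_def successively_rev successively_map
    by (auto elim: successively_mono)
qed

lemma group_free_group: "group (free_group S)"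
proof (rule groupI)
  fix u v
  assume "u \<in> carrier (free_group S)" "v \<in> carrier (free_group S)"
  then show "u \<otimes>\<^bsub>free_group S\<^esub> v \<in> carrier (free_group S)"
    using set_foldr_reduced_cons[of u v]
    by (fastforce simp: free_group_def reduced_word_foldr)
next
  fix u
  assume u: "u \<in> carrier (free_group S)"
  let ?v = "rev (map inv_letter u)"
  have "?v \<in> carrier (free_group S)"
    using u by (auto simp: free_group_def reduced_word_rev inv_letter_def)
  moreover have "?v \<otimes>\<^bsub>free_group S\<^esub> u = \<one>\<^bsub>free_group S\<^esub>"
    by (simp add: free_group_def foldr_reduced_cons_rev)
  ultimately show "\<exists>v\<in>carrier (free_group S). v \<otimes>\<^bsub>free_group S\<^esub> u = \<one>\<^bsub>free_group S\<^esub>"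
    by blast
qed (auto simp: free_group_def reduced_word_def foldr_foldr_reduced_cons)

end

theory Submission
  imports Defs
begin

text \<open>
  Freeness. Put \<open>\<epsilon> = \<sigma>(\<epsilon>, \<epsilon>)\<close>. Then \<open>a = \<epsilon> a'\<close>, \<open>b = \<epsilon> b'\<close>, \<open>c = \<epsilon> c'\<close> with
  \<open>a' = (b', c')\<close>, \<open>b' = (c', b')\<close>, \<open>c' = \<sigma>(a', a')\<close> (the Bellaterra automaton), and it suffices that
  the involutions \<open>\<epsilon>, a', b', c'\<close> generate the free product of four groups of order two. The set of
  relators is closed under sections. As there are finitely many words of each length and sections
  are injective, it is also closed under the letterwise permutations of \<open>a', b', c'\<close> and under the
  involutions that read a word from the left and exchange two of these three letters whenever the
  number of preceding occurrences of \<open>\<epsilon>\<close> and of the third letter is odd. These operations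
  act transitively on the words without repeated neighbours whose occurrences of \<open>\<epsilon>\<close> are at
  given positions, so every nonempty such word has an image that moves the first letter of the tree.

  Classification. In a free group there is no torsion, and an element that commutes with
  one of its conjugates commutes with the conjugating element. Up to symmetry, every other
  three-state automaton generates an abelian group, or has a nontrivial involution, or has
  elements \<open>u\<close>, \<open>g\<close> such that \<open>u\<close> commutes with \<open>g u g\<^sup>-\<^sup>1\<close> but not with \<open>g\<close>. Such
  certificates are short words, and they are checked by computing sections of words.
\<close>

section \<open>Commuting elements of free groups\<close>

lemma free_group_simps [simp]:
  "carrier (free_group S) = {w. reduced_word w \<and> fst ` set w \<subseteq> S}"
  "u \<otimes>\<^bsub>free_group S\<^esub> v = foldr reduced_cons u v"
  "\<one>\<^bsub>free_group S\<^esub> = []"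
  by (auto simp: free_group_def)

lemma inv_free_group:
  assumes "u \<in> carrier (free_group S)"
  shows "inv\<^bsub>free_group S\<^esub> u = rev (map inv_letter u)"
proof -
  interpret group "free_group S" by (rule group_free_group)
  show ?thesis
    by (rule inv_equality)
      (use assms in \<open>auto simp: foldr_reduced_cons_rev reduced_word_rev inv_letter_def\<close>)
qed

section \<open>Cancellation in products and commutation in the free monoid\<close>

lemma reduced_wordD: "reduced_word (u @ v) \<Longrightarrow> reduced_word u \<and> reduced_word v"
  by (auto simp: reduced_word_def successively_append_iff)

lemma reduced_word_append_iff:
  "reduced_word (u @ v) \<longleftrightarrow>
    reduced_word u \<and> reduced_word v \<and> (u = [] \<or> v = [] \<or> hd v \<noteq> inv_letter (last u))"
  by (auto simp: reduced_word_def successively_append_iff)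

lemma foldr_reduced_cons_append:
  assumes "reduced_word (u @ v)"
  shows "foldr reduced_cons u v = u @ v"
  using foldr_reduced_cons_Nil[OF assms] foldr_reduced_cons_Nil[of v] reduced_wordD[OF assms]
  by simp

text \<open>The product of two reduced words is the reduced form of their concatenation, so
  commutation in the free monoid passes to the free group.\<close>

lemma foldr_reduced_cons_commute:
  assumes "reduced_word u" "reduced_word v" "u @ v = v @ u"
  shows "foldr reduced_cons u v = foldr reduced_cons v u"
  using assms by (metis foldr_append foldr_reduced_cons_Nil)

lemma length_foldr_reduced_cons: "length (foldr reduced_cons u v) \<le> length u + length v"
proof (induction u)
  case (Cons x u)
  then show ?case
    by (cases "foldr reduced_cons u v") auto
qed simp

text \<open>Every cancellation removes two letters, so a product of full length involves
  none.\<close>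

lemma foldr_reduced_cons_length:
  assumes "length (foldr reduced_cons u v) = length u + length v"
  shows "foldr reduced_cons u v = u @ v"
  using assms
proof (induction u)
  case (Cons x u)
  have "length (foldr reduced_cons u v) \<le> length u + length v"
    by (rule length_foldr_reduced_cons)
  with Cons show ?case
    by (cases "foldr reduced_cons u v") (auto split: if_splits)
qed simp

lemma append_commute_replicate:
  assumes "u @ v = v @ u"
  shows "concat (replicate n u) @ v = v @ concat (replicate n u)"
proof (induction n)
  case (Suc n)
  then show ?case
    by (metis append.assoc assms concat.simps(2) replicate_Suc)
qed simp

text \<open>A word commuting with \<open>u\<close> commutes with every power of \<open>u\<close> and
  is therefore a prefix of each sufficiently long power. So it is determined by its length.\<close>

lemma append_commute_unique:
  assumes "u \<noteq> []" "u @ v = v @ u" "u @ w = w @ u" "length v = length w"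
  shows "v = w"
proof -
  let ?p = "concat (replicate (length v) u)"
  have "length ?p = length v * length u"
    by (simp add: length_concat sum_list_replicate)
  then have "length v \<le> length ?p"
    using assms(1) by (cases u) auto
  moreover have "?p @ v = v @ ?p" "?p @ w = w @ ?p"
    using append_commute_replicate assms by blast+
  ultimately show ?thesis
    using assms(4) by (metis append_eq_append_conv_if)
qed

text \<open>The words \<open>v @ w\<close> and \<open>w @ v\<close> both commute with
  \<open>u\<close> and have equal length, so the uniqueness above identifies them.\<close>

lemma append_commute_trans:
  assumes "u \<noteq> []" "u @ v = v @ u" "u @ w = w @ u"
  shows "v @ w = w @ v"
  by (rule append_commute_unique[of u]) (use assms in \<open>auto, (metis append.assoc)+\<close>)

text \<open>One of \<open>v\<close> and its inverse does not cancel against \<open>u\<close>, so that commutation can be read off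
  in the free monoid.\<close>

lemma commuting_cyclically_reduced:
  assumes u: "u \<noteq> []" "reduced_word (u @ u)" and v: "reduced_word v"
    and comm: "foldr reduced_cons u v = foldr reduced_cons v u"
    and comm': "foldr reduced_cons u (rev (map inv_letter v)) = foldr reduced_cons (rev (map inv_letter v)) u"
  shows "u @ v = v @ u \<or> u @ rev (map inv_letter v) = rev (map inv_letter v) @ u"
proof (cases "v = [] \<or> hd u \<noteq> inv_letter (last v)")
  case True
  then have "reduced_word (v @ u)"
    using u v by (auto simp: reduced_word_append_iff)
  then have "foldr reduced_cons v u = v @ u"
    by (rule foldr_reduced_cons_append)
  with comm foldr_reduced_cons_length[of u v] show ?thesis
    by simp
next
  case False
  let ?v = "rev (map inv_letter v)"
  have "hd ?v = hd u"
    using False by (simp add: hd_rev last_map)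
  then have "reduced_word (u @ ?v)"
    using u v by (auto simp: reduced_word_append_iff reduced_word_rev)
  then have "foldr reduced_cons u ?v = u @ ?v"
    by (rule foldr_reduced_cons_append)
  then have "foldr reduced_cons ?v u = ?v @ u"
    using comm' by (intro foldr_reduced_cons_length) simp
  then show ?thesis
    using comm' \<open>foldr reduced_cons u ?v = u @ ?v\<close> by simp
qed

text \<open>Reducedness of \<open>u @ u\<close> is the form in which cyclic reducedness is expressed
  here: nothing cancels at the joints of a power.\<close>

lemma reduced_word_concat_replicate:
  assumes "reduced_word (u @ u)"
  shows "reduced_word (concat (replicate n u))"
proof (induction n)
  case (Suc n)
  then show ?case
    using assms
    by (cases n) (auto simp: reduced_word_append_iff)
qed (simp add: reduced_word_def)

section \<open>Centralizers, conjugates and torsion in a free group\<close>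

context
  fixes S :: "'a set" and F :: "('a \<times> bool) list monoid"
  defines "F \<equiv> free_group S"
begin

interpretation F: group F
  unfolding F_def by (rule group_free_group)

lemma commute_inv:
  assumes "x \<in> carrier F" "y \<in> carrier F" "x \<otimes>\<^bsub>F\<^esub> y = y \<otimes>\<^bsub>F\<^esub> x"
  shows "x \<otimes>\<^bsub>F\<^esub> inv\<^bsub>F\<^esub> y = inv\<^bsub>F\<^esub> y \<otimes>\<^bsub>F\<^esub> x"
  using assms by (metis F.inv_closed F.inv_solve_left F.inv_solve_right F.m_assoc F.m_closed)

text \<open>A conjugate of minimal length works: if its first and last letters were inverse to each
  other, conjugating by the inverse of the first letter would remove both.\<close>

lemma cyclically_reduced_conjugate:
  assumes "x \<in> carrier F"
  obtains c where "c \<in> carrier F" "reduced_word ((c \<otimes>\<^bsub>F\<^esub> x \<otimes>\<^bsub>F\<^esub> inv\<^bsub>F\<^esub> c) @ (c \<otimes>\<^bsub>F\<^esub> x \<otimes>\<^bsub>F\<^esub> inv\<^bsub>F\<^esub> c))"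
proof -
  define c where "c = arg_min (\<lambda>c. length (c \<otimes>\<^bsub>F\<^esub> x \<otimes>\<^bsub>F\<^esub> inv\<^bsub>F\<^esub> c)) (\<lambda>c. c \<in> carrier F)"
  have c: "c \<in> carrier F"
    and min: "\<And>d. d \<in> carrier F \<Longrightarrow>
      length (c \<otimes>\<^bsub>F\<^esub> x \<otimes>\<^bsub>F\<^esub> inv\<^bsub>F\<^esub> c) \<le> length (d \<otimes>\<^bsub>F\<^esub> x \<otimes>\<^bsub>F\<^esub> inv\<^bsub>F\<^esub> d)"
    unfolding c_def using arg_min_nat_lemma[of "\<lambda>c. c \<in> carrier F" "\<one>\<^bsub>F\<^esub>"
      "\<lambda>c. length (c \<otimes>\<^bsub>F\<^esub> x \<otimes>\<^bsub>F\<^esub> inv\<^bsub>F\<^esub> c)"] by auto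
  define y where "y = c \<otimes>\<^bsub>F\<^esub> x \<otimes>\<^bsub>F\<^esub> inv\<^bsub>F\<^esub> c"
  have y: "y \<in> carrier F"
    using assms c by (simp add: y_def)
  have "reduced_word (y @ y)"
  proof (rule ccontr)
    assume "\<not> reduced_word (y @ y)"
    then have ne: "y \<noteq> []" and eq: "hd y = inv_letter (last y)"
      using y by (auto simp: reduced_word_append_iff F_def)
    \<comment> \<open>A single letter is excluded because no letter is its own inverse.\<close>
    then obtain l z where yl: "y = l # z" "z \<noteq> []"
      by (cases y) (auto split: if_splits)
    then obtain w where yw: "y = l # w @ [inv_letter l]"
      using eq by (metis append_butlast_last_id inv_letter_inv_letter last_ConsR list.sel(1))
    let ?l = "[inv_letter l]"
    have l: "?l \<in> carrier F"
      using y by (auto simp: F_def yw reduced_word_def inv_letter_def)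
    have rw: "reduced_word w" "reduced_word (w @ [inv_letter l])"
      using y yw by (auto simp: F_def reduced_word_def successively_Cons successively_append_iff)
    have "?l \<otimes>\<^bsub>F\<^esub> y \<otimes>\<^bsub>F\<^esub> inv\<^bsub>F\<^esub> ?l = w"
    proof -
      have "?l \<otimes>\<^bsub>F\<^esub> y = w @ [inv_letter l]"
        by (simp add: F_def yw)
      moreover have "inv\<^bsub>F\<^esub> ?l = [l]"
        using l inv_free_group[of ?l S] by (simp add: F_def)
      moreover have "foldr reduced_cons (w @ [inv_letter l]) [l] = w"
        using foldr_reduced_cons_Nil[OF rw(1)] by simp
      ultimately show ?thesis
        by (simp add: F_def)
    qed
    moreover have "?l \<otimes>\<^bsub>F\<^esub> y \<otimes>\<^bsub>F\<^esub> inv\<^bsub>F\<^esub> ?l =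
      (?l \<otimes>\<^bsub>F\<^esub> c) \<otimes>\<^bsub>F\<^esub> x \<otimes>\<^bsub>F\<^esub> inv\<^bsub>F\<^esub> (?l \<otimes>\<^bsub>F\<^esub> c)"
      using assms c l by (simp add: y_def F.m_assoc F.inv_mult_group)
    ultimately have "length y \<le> length w"
      using min[of "?l \<otimes>\<^bsub>F\<^esub> c"] l c unfolding y_def by (metis F.m_closed)
    then show False
      by (simp add: yw)
  qed
  then show thesis
    using that c by (simp add: y_def)
qed


lemma inv_mult_cancel:
  assumes "x \<in> carrier F" "y \<in> carrier F"
  shows "inv\<^bsub>F\<^esub> x \<otimes>\<^bsub>F\<^esub> (x \<otimes>\<^bsub>F\<^esub> y) = y"
  using F.m_assoc[of "inv\<^bsub>F\<^esub> x" x y] assms by (simp add: F.l_inv)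

lemma conjugate_mult:
  assumes "c \<in> carrier F" "x \<in> carrier F" "y \<in> carrier F"
  shows "(c \<otimes>\<^bsub>F\<^esub> x \<otimes>\<^bsub>F\<^esub> inv\<^bsub>F\<^esub> c) \<otimes>\<^bsub>F\<^esub> (c \<otimes>\<^bsub>F\<^esub> y \<otimes>\<^bsub>F\<^esub> inv\<^bsub>F\<^esub> c) = c \<otimes>\<^bsub>F\<^esub> (x \<otimes>\<^bsub>F\<^esub> y) \<otimes>\<^bsub>F\<^esub> inv\<^bsub>F\<^esub> c"
  using assms by (simp add: F.m_assoc inv_mult_cancel)

lemma conjugate_inj:
  assumes "c \<in> carrier F" "x \<in> carrier F" "y \<in> carrier F"
    "c \<otimes>\<^bsub>F\<^esub> x \<otimes>\<^bsub>F\<^esub> inv\<^bsub>F\<^esub> c = c \<otimes>\<^bsub>F\<^esub> y \<otimes>\<^bsub>F\<^esub> inv\<^bsub>F\<^esub> c"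
  shows "x = y"
  using assms by (metis F.inv_closed F.m_closed F.l_cancel F.r_cancel)

lemma conjugate_one:
  assumes "c \<in> carrier F" "x \<in> carrier F" "c \<otimes>\<^bsub>F\<^esub> x \<otimes>\<^bsub>F\<^esub> inv\<^bsub>F\<^esub> c = \<one>\<^bsub>F\<^esub>"
  shows "x = \<one>\<^bsub>F\<^esub>"
  using conjugate_inj[of c x "\<one>\<^bsub>F\<^esub>"] assms by (simp add: F.r_inv)

lemma commuting_append:
  assumes "x \<in> carrier F" "x \<noteq> \<one>\<^bsub>F\<^esub>" "reduced_word (x @ x)" "y \<in> carrier F"
    and "x \<otimes>\<^bsub>F\<^esub> y = y \<otimes>\<^bsub>F\<^esub> x"
  obtains z where "z = y \<or> z = inv\<^bsub>F\<^esub> y" "x @ z = z @ x"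
  using commuting_cyclically_reduced[of x y] commute_inv[of x y] inv_free_group[of y S] assms
  unfolding F_def by auto

lemma commute_append:
  assumes "y \<in> carrier F" "z \<in> carrier F" "y @ z = z @ y"
  shows "y \<otimes>\<^bsub>F\<^esub> z = z \<otimes>\<^bsub>F\<^esub> y"
  using foldr_reduced_cons_commute[of y z] assms by (simp add: F_def)

text \<open>After replacing \<open>y\<close> and \<open>z\<close> by their inverses where necessary,
  both commute with \<open>x\<close> in the free monoid, where commutation through a nonempty word
  is transitive. Passing to inverses does not affect commutation.\<close>

lemma commute_trans_cyclically_reduced:
  assumes x: "x \<in> carrier F" "x \<noteq> \<one>\<^bsub>F\<^esub>" "reduced_word (x @ x)"
    and y: "y \<in> carrier F" and z: "z \<in> carrier F"
    and xy: "x \<otimes>\<^bsub>F\<^esub> y = y \<otimes>\<^bsub>F\<^esub> x" and xz: "x \<otimes>\<^bsub>F\<^esub> z = z \<otimes>\<^bsub>F\<^esub> x"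
  shows "y \<otimes>\<^bsub>F\<^esub> z = z \<otimes>\<^bsub>F\<^esub> y"
proof -
  obtain y' where y': "y' = y \<or> y' = inv\<^bsub>F\<^esub> y" "x @ y' = y' @ x"
    using commuting_append[OF x y xy] .
  obtain z' where z': "z' = z \<or> z' = inv\<^bsub>F\<^esub> z" "x @ z' = z' @ x"
    using commuting_append[OF x z xz] .
  have cl: "y' \<in> carrier F" "z' \<in> carrier F"
    using y' z' y z by auto
  have "x \<noteq> []"
    using x by (simp add: F_def)
  then have "y' \<otimes>\<^bsub>F\<^esub> z' = z' \<otimes>\<^bsub>F\<^esub> y'"
    using append_commute_trans y' z' cl by (intro commute_append) auto
  then have "y' \<otimes>\<^bsub>F\<^esub> z = z \<otimes>\<^bsub>F\<^esub> y'"
    using z' cl z commute_inv[of y' z'] by auto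
  then show ?thesis
    using y' cl y z commute_inv[of z y'] by auto
qed

text \<open>Conjugating all three elements simultaneously makes \<open>x\<close> cyclically
  reduced.\<close>

lemma commute_trans:
  assumes x: "x \<in> carrier F" "x \<noteq> \<one>\<^bsub>F\<^esub>" and y: "y \<in> carrier F" and z: "z \<in> carrier F"
    and xy: "x \<otimes>\<^bsub>F\<^esub> y = y \<otimes>\<^bsub>F\<^esub> x" and xz: "x \<otimes>\<^bsub>F\<^esub> z = z \<otimes>\<^bsub>F\<^esub> x"
  shows "y \<otimes>\<^bsub>F\<^esub> z = z \<otimes>\<^bsub>F\<^esub> y"
proof -
  obtain c where c: "c \<in> carrier F" "reduced_word ((c \<otimes>\<^bsub>F\<^esub> x \<otimes>\<^bsub>F\<^esub> inv\<^bsub>F\<^esub> c) @ (c \<otimes>\<^bsub>F\<^esub> x \<otimes>\<^bsub>F\<^esub> inv\<^bsub>F\<^esub> c))"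
    using cyclically_reduced_conjugate x(1) .
  let ?k = "\<lambda>w. c \<otimes>\<^bsub>F\<^esub> w \<otimes>\<^bsub>F\<^esub> inv\<^bsub>F\<^esub> c"
  have "?k y \<otimes>\<^bsub>F\<^esub> ?k z = ?k z \<otimes>\<^bsub>F\<^esub> ?k y"
  proof (rule commute_trans_cyclically_reduced[of "?k x"])
    show "?k x \<noteq> \<one>\<^bsub>F\<^esub>"
      using conjugate_one c x by blast
  qed (use c x y z xy xz in \<open>auto simp: conjugate_mult\<close>)
  then have "?k (y \<otimes>\<^bsub>F\<^esub> z) = ?k (z \<otimes>\<^bsub>F\<^esub> y)"
    using c y z by (simp add: conjugate_mult)
  then show ?thesis
    using conjugate_inj[of c] c y z by blast
qed

text \<open>An element of square one is its own inverse, so its word equals the reversed word of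
  inverse letters. In the middle this forces two adjacent inverse letters, or a letter that is its
  own inverse, according to the parity of the length.\<close>

lemma square_eq_one:
  assumes x: "x \<in> carrier F" and sq: "x \<otimes>\<^bsub>F\<^esub> x = \<one>\<^bsub>F\<^esub>"
  shows "x = \<one>\<^bsub>F\<^esub>"
proof (rule ccontr)
  assume "x \<noteq> \<one>\<^bsub>F\<^esub>"
  then have ne: "length x > 0"
    by (simp add: F_def)
  have "x = inv\<^bsub>F\<^esub> x"
    using F.inv_equality[OF sq x x] by simp
  then have eq: "x = rev (map inv_letter x)"
    using inv_free_group[of x S] x by (simp add: F_def)
  have nth: "x ! i = inv_letter (x ! (length x - Suc i))" if "i < length x" for i
    using that by (subst eq) (simp add: rev_nth)
  have red: "successively (\<lambda>x y. y \<noteq> inv_letter x) x"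
    using x by (simp add: F_def reduced_word_def)
  define k where "k = length x div 2"
  show False
  proof (cases "even (length x)")
    case True
    then have "length x = 2 * k" "k > 0"
      using ne unfolding k_def by presburger+
    then have "x ! Suc (k - 1) = inv_letter (x ! (k - 1))"
      using nth[of k] by (simp add: mult_2)
    moreover have "Suc (k - 1) < length x"
      using \<open>length x = 2 * k\<close> \<open>k > 0\<close> by simp
    ultimately show False
      using red by (auto simp: successively_conv_nth)
  next
    case False
    then have "length x = Suc (2 * k)"
      by (auto simp: k_def elim!: oddE)
    then show False
      using nth[of k] by simp
  qed
qed

lemma nat_pow_cyclically_reduced:
  assumes "x \<in> carrier F" "reduced_word (x @ x)"
  shows "x [^]\<^bsub>F\<^esub> n = concat (replicate n x)"
proof (induction n)
  case 0
  then show ?case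
    by (simp add: F_def)
next
  case (Suc n)
  have "reduced_word (x @ concat (replicate n x))"
    using reduced_word_concat_replicate[OF assms(2), of "Suc n"] by simp
  then have "x \<otimes>\<^bsub>F\<^esub> concat (replicate n x) = x @ concat (replicate n x)"
    by (simp add: F_def foldr_reduced_cons_append)
  then show ?case
    using Suc F.nat_pow_Suc2[OF assms(1), of n] by simp
qed

text \<open>Powers of cyclically reduced words have proportional length, while conjugation by
  \<open>g\<close> adds at most twice the length of \<open>g\<close> to any power.\<close>

lemma length_conjugate_le:
  assumes x: "x \<in> carrier F" "reduced_word (x @ x)" and y: "y \<in> carrier F" "reduced_word (y @ y)"
    and g: "g \<in> carrier F" and conj: "y = g \<otimes>\<^bsub>F\<^esub> x \<otimes>\<^bsub>F\<^esub> inv\<^bsub>F\<^esub> g"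
  shows "length y \<le> length x"
proof -
  \<comment> \<open>The exponent exceeds all that conjugation can add, so one extra letter in
    \<open>y\<close>, repeated \<open>n\<close> times, would be too much.\<close>
  define n where "n = Suc (2 * length g)"
  have "y [^]\<^bsub>F\<^esub> m = g \<otimes>\<^bsub>F\<^esub> x [^]\<^bsub>F\<^esub> m \<otimes>\<^bsub>F\<^esub> inv\<^bsub>F\<^esub> g" for m :: nat
  proof (induction m)
    case 0
    then show ?case
      using g by (simp add: F.r_inv)
  next
    case (Suc m)
    then show ?case
      using x g conjugate_mult[of g "x [^]\<^bsub>F\<^esub> m" x] by (simp add: conj)
  qed
  then have "y [^]\<^bsub>F\<^esub> n = g \<otimes>\<^bsub>F\<^esub> x [^]\<^bsub>F\<^esub> n \<otimes>\<^bsub>F\<^esub> inv\<^bsub>F\<^esub> g" .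
  moreover have "length (g \<otimes>\<^bsub>F\<^esub> w \<otimes>\<^bsub>F\<^esub> inv\<^bsub>F\<^esub> g) \<le> 2 * length g + length w" for w
    using length_foldr_reduced_cons[of "foldr reduced_cons g w" "inv\<^bsub>F\<^esub> g"]
      length_foldr_reduced_cons[of g w] inv_free_group[of g S] g
    by (simp add: F_def)
  ultimately have "length (concat (replicate n y)) \<le> 2 * length g + length (concat (replicate n x))"
    by (simp only: nat_pow_cyclically_reduced[OF x, of n, symmetric]
      nat_pow_cyclically_reduced[OF y, of n, symmetric])
  then have "n * length y < n * Suc (length x)"
    by (simp add: length_concat sum_list_replicate n_def)
  then show ?thesis
    by (metis less_Suc_eq_le nat_mult_less_cancel1 nat_mult_less_cancel_disj)
qed

text \<open>The conjugate of \<open>x\<close> or its inverse commutes with \<open>x\<close> as a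
  word. It is cyclically reduced of the same length as \<open>x\<close>, hence equal to
  \<open>x\<close>. So \<open>g\<close> either centralizes or inverts \<open>x\<close>, and
  inversion is dealt with through the square of \<open>g\<close>.\<close>

lemma commute_conjugate_cyclically_reduced:
  assumes x: "x \<in> carrier F" "x \<noteq> \<one>\<^bsub>F\<^esub>" "reduced_word (x @ x)" and g: "g \<in> carrier F"
    and comm: "x \<otimes>\<^bsub>F\<^esub> (g \<otimes>\<^bsub>F\<^esub> x \<otimes>\<^bsub>F\<^esub> inv\<^bsub>F\<^esub> g) = (g \<otimes>\<^bsub>F\<^esub> x \<otimes>\<^bsub>F\<^esub> inv\<^bsub>F\<^esub> g) \<otimes>\<^bsub>F\<^esub> x"
  shows "x \<otimes>\<^bsub>F\<^esub> g = g \<otimes>\<^bsub>F\<^esub> x"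
proof -
  define v where "v = g \<otimes>\<^bsub>F\<^esub> x \<otimes>\<^bsub>F\<^esub> inv\<^bsub>F\<^esub> g"
  have v: "v \<in> carrier F"
    using x g by (simp add: v_def)
  have ne: "x \<noteq> []"
    using x by (simp add: F_def)
  obtain w where w: "w = v \<or> w = inv\<^bsub>F\<^esub> v" "x @ w = w @ x"
    using commuting_append[OF x v] comm unfolding v_def by blast
  obtain t where t: "t = x \<or> t = inv\<^bsub>F\<^esub> x" "w = g \<otimes>\<^bsub>F\<^esub> t \<otimes>\<^bsub>F\<^esub> inv\<^bsub>F\<^esub> g"
  proof (cases "w = v")
    case True
    then show ?thesis
      using that v_def by blast
  next
    case False
    then have "w = g \<otimes>\<^bsub>F\<^esub> inv\<^bsub>F\<^esub> x \<otimes>\<^bsub>F\<^esub> inv\<^bsub>F\<^esub> g"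
      using w(1) x g by (simp add: v_def F.inv_mult_group F.m_assoc)
    then show ?thesis
      using that by blast
  qed
  have tc: "t \<in> carrier F" and wc: "w \<in> carrier F"
    using t x w v by auto
  have inv_x: "inv\<^bsub>F\<^esub> x = rev (map inv_letter x)"
    using inv_free_group[of x S] x by (simp add: F_def)
  have tr: "reduced_word (t @ t)" and tl: "length t = length x"
    using t(1) x(3) reduced_word_rev[of "x @ x"] by (auto simp: inv_x)
  \<comment> \<open>A power of \<open>x\<close> at least as long as \<open>w @ w\<close>; since the
    two commute as words, \<open>w @ w\<close> is a prefix of it and hence reduced.\<close>
  let ?p = "concat (replicate (length (w @ w)) x)"
  have "?p @ w @ w = (w @ w) @ ?p"
    by (rule append_commute_replicate) (metis append.assoc w(2))
  moreover have "length (w @ w) \<le> length ?p"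
    using ne by (cases x) (auto simp: length_concat sum_list_replicate)
  ultimately have "take (length (w @ w)) ?p = take (length (w @ w)) ((w @ w) @ ?p)"
    by (metis append.right_neutral diff_is_0_eq take0 take_append)
  then have "(w @ w) @ drop (length (w @ w)) ?p = ?p"
    using append_take_drop_id[of "length (w @ w)" ?p] by simp
  then have wr: "reduced_word (w @ w)"
    using reduced_wordD[of "w @ w" "drop (length (w @ w)) ?p"]
      reduced_word_concat_replicate[OF x(3), of "length (w @ w)"] by argo
  have "length w = length x"
  proof (rule antisym)
    show "length w \<le> length x"
      using length_conjugate_le[OF tc tr wc wr g t(2)] tl by simp
    have t': "t = inv\<^bsub>F\<^esub> g \<otimes>\<^bsub>F\<^esub> w \<otimes>\<^bsub>F\<^esub> inv\<^bsub>F\<^esub> (inv\<^bsub>F\<^esub> g)"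
      using t(2) tc g by (simp add: F.m_assoc inv_mult_cancel)
    show "length x \<le> length w"
      using length_conjugate_le[OF wc wr tc tr F.inv_closed[OF g] t'] tl by simp
  qed
  then have "x = w"
    by (intro append_commute_unique[OF ne refl w(2)]) (rule sym)
  then have gt: "x \<otimes>\<^bsub>F\<^esub> g = g \<otimes>\<^bsub>F\<^esub> t"
    using t(2) tc g by (simp add: F.m_assoc F.l_inv)
  show ?thesis
  proof (cases "t = x \<or> g = \<one>\<^bsub>F\<^esub>")
    case True
    then show ?thesis
      using gt F.l_one[OF x(1)] F.r_one[OF x(1)] by metis
  next
    case False
    \<comment> \<open>Here \<open>g\<close> inverts \<open>x\<close>, so the square of
      \<open>g\<close> commutes with both \<open>x\<close> and \<open>g\<close>. It is nontrivial
      because there is no torsion, and commutation is transitive through it.\<close>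
    then have ti: "t = inv\<^bsub>F\<^esub> x" and g1: "g \<noteq> \<one>\<^bsub>F\<^esub>"
      using t by auto
    note gt = gt[unfolded ti]
    have ix: "inv\<^bsub>F\<^esub> x \<in> carrier F"
      using x(1) by (rule F.inv_closed)
    have "x \<otimes>\<^bsub>F\<^esub> (g \<otimes>\<^bsub>F\<^esub> x) = (g \<otimes>\<^bsub>F\<^esub> inv\<^bsub>F\<^esub> x) \<otimes>\<^bsub>F\<^esub> x"
      by (simp only: F.m_assoc[OF x(1) g x(1), symmetric] gt)
    also have "\<dots> = g"
      by (simp only: F.m_assoc[OF g ix x(1)] F.l_inv[OF x(1)] F.r_one[OF g])
    finally have xgx: "x \<otimes>\<^bsub>F\<^esub> (g \<otimes>\<^bsub>F\<^esub> x) = g" .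
    have gx: "g \<otimes>\<^bsub>F\<^esub> x = inv\<^bsub>F\<^esub> x \<otimes>\<^bsub>F\<^esub> g"
      using inv_mult_cancel[OF x(1) F.m_closed[OF g x(1)]] unfolding xgx by (rule sym)
    have "(g \<otimes>\<^bsub>F\<^esub> g) \<otimes>\<^bsub>F\<^esub> x = g \<otimes>\<^bsub>F\<^esub> (inv\<^bsub>F\<^esub> x \<otimes>\<^bsub>F\<^esub> g)"
      by (simp only: F.m_assoc[OF g g x(1)] gx)
    also have "\<dots> = (x \<otimes>\<^bsub>F\<^esub> g) \<otimes>\<^bsub>F\<^esub> g"
      by (simp only: F.m_assoc[OF g ix g, symmetric] gt)
    also have "\<dots> = x \<otimes>\<^bsub>F\<^esub> (g \<otimes>\<^bsub>F\<^esub> g)"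
      by (rule F.m_assoc[OF x(1) g g])
    finally have comm2: "(g \<otimes>\<^bsub>F\<^esub> g) \<otimes>\<^bsub>F\<^esub> x = x \<otimes>\<^bsub>F\<^esub> (g \<otimes>\<^bsub>F\<^esub> g)" .
    have "g \<otimes>\<^bsub>F\<^esub> g \<noteq> \<one>\<^bsub>F\<^esub>"
      using square_eq_one g g1 by blast
    from commute_trans[OF F.m_closed[OF g g] this x(1) g comm2 F.m_assoc[OF g g g]]
    show ?thesis .
  qed
qed

text \<open>For nontrivial \<open>x\<close>, conjugate \<open>x\<close> and \<open>g\<close>
  simultaneously so that \<open>x\<close> becomes cyclically reduced.\<close>

lemma commute_conjugate:
  assumes x: "x \<in> carrier F" and g: "g \<in> carrier F"
    and comm: "x \<otimes>\<^bsub>F\<^esub> (g \<otimes>\<^bsub>F\<^esub> x \<otimes>\<^bsub>F\<^esub> inv\<^bsub>F\<^esub> g) = (g \<otimes>\<^bsub>F\<^esub> x \<otimes>\<^bsub>F\<^esub> inv\<^bsub>F\<^esub> g) \<otimes>\<^bsub>F\<^esub> x"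
  shows "x \<otimes>\<^bsub>F\<^esub> g = g \<otimes>\<^bsub>F\<^esub> x"
proof (cases "x = \<one>\<^bsub>F\<^esub>")
  case True
  then show ?thesis
    using g by (simp)
next
  case False
  obtain c where c: "c \<in> carrier F" "reduced_word ((c \<otimes>\<^bsub>F\<^esub> x \<otimes>\<^bsub>F\<^esub> inv\<^bsub>F\<^esub> c) @ (c \<otimes>\<^bsub>F\<^esub> x \<otimes>\<^bsub>F\<^esub> inv\<^bsub>F\<^esub> c))"
    using cyclically_reduced_conjugate x .
  let ?k = "\<lambda>w. c \<otimes>\<^bsub>F\<^esub> w \<otimes>\<^bsub>F\<^esub> inv\<^bsub>F\<^esub> c"
  have inv_k: "inv\<^bsub>F\<^esub> ?k g = ?k (inv\<^bsub>F\<^esub> g)"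
    using c g by (simp add: F.inv_mult_group F.m_assoc)
  have "?k x \<otimes>\<^bsub>F\<^esub> ?k g = ?k g \<otimes>\<^bsub>F\<^esub> ?k x"
  proof (rule commute_conjugate_cyclically_reduced)
    show "?k x \<noteq> \<one>\<^bsub>F\<^esub>"
      using conjugate_one c x False by blast
  qed (use c x g comm in \<open>auto simp: conjugate_mult inv_k\<close>)
  then have "?k (x \<otimes>\<^bsub>F\<^esub> g) = ?k (g \<otimes>\<^bsub>F\<^esub> x)"
    using c x g by (simp add: conjugate_mult)
  then show ?thesis
    using conjugate_inj[OF c(1) F.m_closed[OF x g] F.m_closed[OF g x]] by blast
qed

end

section \<open>The free product of four groups of order two\<close>

text \<open>The transposition is indexed by the state it fixes, so that conjugating one
  transposition by another just applies the latter to the index.\<close>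

fun exchange :: "state \<Rightarrow> state \<Rightarrow> state" where
  "exchange Sa Sb = Sc" | "exchange Sa Sc = Sb"
| "exchange Sb Sa = Sc" | "exchange Sb Sc = Sa"
| "exchange Sc Sa = Sb" | "exchange Sc Sb = Sa"
| "exchange r q = q"

lemma exchange_exchange [simp]: "exchange r (exchange r q) = q"
  by (cases r; cases q) auto

lemma exchange_same [simp]: "exchange r r = r"
  by (cases r) auto

lemma exchange_conj: "exchange p (exchange r q) = exchange (exchange p r) (exchange p q)"
  by (cases p; cases r; cases q) auto

lemma exchange_eq_iff [simp]: "exchange r p = exchange r q \<longleftrightarrow> p = q"
  by (metis exchange_exchange)

lemma exchange_eq_self [simp]: "exchange r p = r \<longleftrightarrow> p = r"
  by (metis exchange_exchange exchange_same)

lemma bij_exchange: "bij (exchange r)"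
  by (rule involuntory_imp_bij) simp

lemma bij_if_exchange: "bij (if b then exchange r else (\<lambda>y. y))"
  using bij_exchange bij_id[unfolded id_def] by auto

section \<open>Words in the four involutions, their twists and parities\<close>

abbreviation swap_word :: "state \<Rightarrow> state option list \<Rightarrow> state option list" where
  "swap_word r \<equiv> map (map_option (exchange r))"

text \<open>In words, \<open>None\<close> stands for \<epsilon> and \<open>Some q\<close> for the
  primed state. The letters toggled for \<open>Sc\<close> are exactly those that invert the first
  letter of the tree; the other indices arise by symmetry.\<close>

definition toggles :: "state \<Rightarrow> state option \<Rightarrow> bool" where
  "toggles r q \<longleftrightarrow> q = None \<or> q = Some r"

text \<open>The Boolean carries the parity of the toggling letters read so far, with an arbitrary
  initial value. For \<open>r = Sc\<close> it is the tree letter that reaches the current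
  factor.\<close>

fun twist :: "state \<Rightarrow> bool \<Rightarrow> state option list \<Rightarrow> state option list" where
  "twist r x [] = []"
| "twist r x (q # w) = (if x then map_option (exchange r) q else q) # twist r (x \<noteq> toggles r q) w"

fun parity :: "state \<Rightarrow> state option list \<Rightarrow> bool" where
  "parity r [] = False"
| "parity r (q # w) = (parity r w \<noteq> toggles r q)"

definition pattern :: "state option list \<Rightarrow> bool list" where
  "pattern w = map (\<lambda>q. q = None) w"

lemma pattern_simps [simp]:
  "pattern [] = []" "pattern (q # w) = (q = None) # pattern w"
  "pattern (u @ v) = pattern u @ pattern v" "pattern (rev u) = rev (pattern u)"
  "pattern (swap_word r w) = pattern w" "length (pattern w) = length w"
  by (auto simp: pattern_def rev_map)

lemma length_twist [simp]: "length (twist r x w) = length w"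
  by (induction w arbitrary: x) auto

lemma toggles_swap [simp]: "toggles r (map_option (exchange r) q) = toggles r q"
  by (cases q) (auto simp: toggles_def)

lemma toggles_swap': "toggles (exchange p r) (map_option (exchange p) q) = toggles r q"
  by (cases q) (auto simp: toggles_def)

lemma swap_word_swap_word [simp]: "swap_word r (swap_word r w) = w"
  by (simp add: option.map_comp comp_def option.map_ident)

lemma twist_append: "twist r x (u @ v) = twist r x u @ twist r (x \<noteq> parity r u) v"
proof (induction u arbitrary: x)
  case (Cons q u)
  have "((x \<noteq> toggles r q) \<noteq> parity r u) = (x \<noteq> parity r (q # u))"
    by auto
  with Cons show ?case
    by simp
qed simp

lemma parity_append: "parity r (u @ v) = (parity r u \<noteq> parity r v)"
  by (induction u) auto

lemma parity_rev [simp]: "parity r (rev w) = parity r w"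
  by (induction w) (auto simp: parity_append)

lemma twist_twist [simp]: "twist r x (twist r x w) = w"
  by (induction w arbitrary: x) (auto simp: option.map_comp comp_def option.map_ident)

lemma twist_Not: "twist r (\<not> x) w = swap_word r (twist r x w)"
proof (induction w arbitrary: x)
  case (Cons q w)
  have "twist r (\<not> x \<noteq> toggles r q) w = twist r (\<not> (x \<noteq> toggles r q)) w"
    by (rule arg_cong[of _ _ "\<lambda>y. twist r y w"]) auto
  with Cons[of "x \<noteq> toggles r q"] show ?case
    by (cases q) auto
qed simp

lemma swap_word_twist: "swap_word p (twist r x w) = twist (exchange p r) x (swap_word p w)"
proof (induction w arbitrary: x)
  case (Cons q w)
  then show ?case
    by (cases q) (auto simp: toggles_swap' exchange_conj[of p r] toggles_def)
qed simp

text \<open>Read from the other end, the parity before a letter changes by the total parity and by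
  the toggle of the letter itself. The latter does no harm, since \<open>exchange r\<close> fixes
  all toggling letters.\<close>

lemma rev_twist: "rev (twist r x w) = twist r (x \<noteq> parity r w) (rev w)"
proof (induction w arbitrary: x)
  case (Cons q w)
  have 1: "(x \<noteq> parity r (q # w)) = ((x \<noteq> toggles r q) \<noteq> parity r w)"
    by auto
  have 2: "(((x \<noteq> toggles r q) \<noteq> parity r w) \<noteq> parity r w) = (x \<noteq> toggles r q)"
    by auto
  have "(if x then map_option (exchange r) q else q) =
      (if x \<noteq> toggles r q then map_option (exchange r) q else q)"
    by (auto simp: toggles_def)
  moreover have "rev (twist r x (q # w)) =
      twist r ((x \<noteq> toggles r q) \<noteq> parity r w) (rev w) @ [if x then map_option (exchange r) q else q]"
    by (simp only: twist.simps rev.simps Cons)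
  moreover have "twist r (x \<noteq> parity r (q # w)) (rev (q # w)) =
      twist r ((x \<noteq> toggles r q) \<noteq> parity r w) (rev w) @
        [if x \<noteq> toggles r q then map_option (exchange r) q else q]"
    by (simp only: 1 2 twist_append rev.simps parity_rev twist.simps)
  ultimately show ?case
    by simp
qed simp

lemma pattern_twist [simp]: "pattern (twist r x w) = pattern w"
  by (induction w arbitrary: x) auto

text \<open>Two neighbours are treated alike unless the first one toggles; in that case
  \<open>exchange r\<close> fixes the first, so they may again be regarded as treated alike.\<close>

lemma distinct_adj_twistI: "distinct_adj w \<Longrightarrow> distinct_adj (twist r x w)"
proof (induction w arbitrary: x)
  case (Cons q w)
  show ?case
  proof (cases w)
    case w: (Cons p v)
    let ?s = "map_option (exchange r)"
    have "?s q \<noteq> ?s p" "toggles r q \<Longrightarrow> ?s q = q"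
      using Cons.prems w by (auto simp: inj_eq[OF option.inj_map[OF bij_is_inj[OF bij_exchange]]] toggles_def)
    then show ?thesis
      using Cons.prems w Cons.IH[of "x \<noteq> toggles r q"] by (auto simp del: option.map_sel)
  qed simp
qed simp

lemma distinct_adj_twist [simp]: "distinct_adj (twist r x w) \<longleftrightarrow> distinct_adj w"
  using distinct_adj_twistI[of w r x] distinct_adj_twistI[of "twist r x w" r x] by auto

lemma distinct_adj_swap_word [simp]: "distinct_adj (swap_word r w) \<longleftrightarrow> distinct_adj w"
proof -
  have "swap_word r w = twist r True (twist r False w)"
    using twist_Not[of r False "twist r False w"] by simp
  then show ?thesis
    by (simp only: distinct_adj_twist)
qed

section \<open>Orbits of the twists on words with a given pattern\<close>

definition linked :: "state option list \<Rightarrow> state option list \<Rightarrow> bool" where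
  "linked = (\<lambda>u v. \<exists>r. v = twist r True u)\<^sup>*\<^sup>*"

lemma linked_refl [simp]: "linked u u"
  by (simp add: linked_def)

lemma linked_trans [trans]: "linked u v \<Longrightarrow> linked v w \<Longrightarrow> linked u w"
  by (simp add: linked_def)

lemma linked_twist: "linked u (twist r True u)"
  by (auto simp: linked_def)

lemma linked_induct [consumes 1, case_names refl step]:
  assumes "linked u v" "P u" "\<And>w r. linked u w \<Longrightarrow> P w \<Longrightarrow> P (twist r True w)"
  shows "P v"
  using assms(1) unfolding linked_def
  by (induction rule: rtranclp_induct) (use assms in \<open>auto simp: linked_def\<close>)

lemma linked_sym: "linked u v \<Longrightarrow> linked v u"
  by (induction rule: linked_induct) (use linked_trans linked_twist twist_twist in metis)+

lemma linked_distinct_adj: "linked u v \<Longrightarrow> distinct_adj v = distinct_adj u"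
  by (induction rule: linked_induct) auto

lemma linked_swap_word: "linked u v \<Longrightarrow> linked (swap_word p u) (swap_word p v)"
  by (induction rule: linked_induct) (auto simp: swap_word_twist intro: linked_trans linked_twist)

lemma linked_append_None: "linked u v \<Longrightarrow> linked (u @ [None]) (v @ [None])"
proof (induction rule: linked_induct)
  case (step w r)
  then show ?case
    using linked_trans[OF step(2) linked_twist[of _ r]] by (simp add: twist_append split: if_splits)
qed simp

text \<open>What a twist does to the last letter depends only on the word before it, so one
  bijection serves all extensions.\<close>

lemma linked_append_Some:
  "linked u v \<Longrightarrow> \<exists>f. bij f \<and> (\<forall>z. linked (u @ [Some z]) (v @ [Some (f z)]))"
proof (induction rule: linked_induct)
  case refl
  show ?case
    by (rule exI[of _ "\<lambda>z. z"]) (simp add: bij_id[unfolded id_def])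
next
  case (step w r)
  then obtain f where f: "bij f" "\<And>z. linked (u @ [Some z]) (w @ [Some (f z)])"
    by blast
  define g where "g = (if \<not> parity r w then exchange r else (\<lambda>z. z))"
  have "linked (w @ [Some z]) (twist r True w @ [Some (g z)])" for z
    using linked_twist[of "w @ [Some z]" r] by (simp add: twist_append g_def split: if_splits)
  then have "linked (u @ [Some z]) (twist r True w @ [Some ((g \<circ> f) z)])" for z
    using f linked_trans by (metis comp_apply)
  moreover have "bij g"
    unfolding g_def by (rule bij_if_exchange)
  then have "bij (g \<circ> f)"
    using f(1) by (rule bij_comp[rotated])
  ultimately show ?case
    by blast
qed

text \<open>Every maximal block of states ends in \<open>Sc\<close>, preceded by alternating
  \<open>Sa\<close> and \<open>Sb\<close>. Thus a block contributes a single toggle for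
  \<open>Sc\<close>, which the next \<open>None\<close> cancels.\<close>

fun canonical :: "bool list \<Rightarrow> state option list" where
  "canonical [] = []"
| "canonical (True # p) = None # canonical p"
| "canonical (False # p) =
    Some (if p = [] \<or> hd p then Sc else if hd (canonical p) = Some Sa then Sb else Sa) # canonical p"

abbreviation valid_pattern :: "bool list \<Rightarrow> bool" where
  "valid_pattern \<equiv> successively (\<lambda>x y. \<not> (x \<and> y))"

lemma valid_pattern_pattern: "distinct_adj w \<Longrightarrow> valid_pattern (pattern w)"
proof (induction w)
  case (Cons q w)
  then show ?case
    by (cases w; cases q) (auto simp: successively_Cons distinct_adj_Cons dest!: not_sym[of None])
qed simp

lemma canonical_eq_Nil [simp]: "canonical p = [] \<longleftrightarrow> p = []"
  by (cases p rule: canonical.cases) auto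

lemma hd_canonical: "p \<noteq> [] \<Longrightarrow> hd (canonical p) = None \<longleftrightarrow> hd p"
  by (cases p rule: canonical.cases) auto

text \<open>Started at \<open>hd p\<close>, the parity is odd only before each \<open>None\<close>
  and at the end. So every \<open>Sa\<close> and \<open>Sb\<close> is met with even parity and
  nothing is exchanged.\<close>

lemma canonical_fixed:
  assumes "p \<noteq> []" "\<not> last p" "valid_pattern p"
  shows "twist Sc (hd p) (canonical p) = canonical p \<and> parity Sc (canonical p) = (\<not> hd p) \<and>
    distinct_adj (canonical p) \<and> pattern (canonical p) = p \<and> last (canonical p) = Some Sc"
  using assms
proof (induction p rule: canonical.induct)
  case (2 p)
  then have "p \<noteq> []" "\<not> hd p"
    by (auto simp: successively_Cons split: if_splits)
  moreover from this have "None \<noteq> hd (canonical p)"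
    using hd_canonical by force
  ultimately show ?case
    using 2 by (auto simp: toggles_def distinct_adj_Cons successively_Cons)
next
  case (3 p)
  show ?case
  proof (cases "p = []")
    case False
    show ?thesis
    proof (cases "hd p")
      case True
      then show ?thesis
        using 3 hd_canonical[OF False]
        by (auto simp: toggles_def distinct_adj_Cons successively_Cons)
    next
      case hd: False
      then have "None \<noteq> hd (canonical p)"
        using hd_canonical[OF False] by force
      then show ?thesis
        using 3 False hd by (auto simp: toggles_def distinct_adj_Cons successively_Cons)
    qed
  qed (auto simp: toggles_def)
qed simp

lemma linked_singleton: "linked [Some p] [Some q]"
proof (cases "p = q")
  case False
  then obtain r where "exchange r p = q"
    by (cases p; cases q) (use exchange.simps in blast)+
  then show ?thesis
    using linked_twist[of "[Some p]" r] by simp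
qed simp

text \<open>Otherwise there are exactly two classes, and they are exchanged by the letterwise transposition
  that fixes \<open>Sc\<close>, because the canonical word of \<open>p\<close> is fixed by a twist that exchanges its two
  extensions. But the canonical word of \<open>p @ [False]\<close> is linked to its own image.\<close>

lemma linked_extend_state:
  assumes IH: "\<And>u v. distinct_adj u \<Longrightarrow> distinct_adj v \<Longrightarrow> pattern u = p \<Longrightarrow> pattern v = p \<Longrightarrow> linked u v"
    and p: "p \<noteq> []" "\<not> last p" "\<not> hd p"
    and u: "distinct_adj u" "pattern u = p @ [False]" and v: "distinct_adj v" "pattern v = p @ [False]"
  shows "linked u v"
proof -
  define k where "k = canonical p"
  have vp: "valid_pattern (p @ [False])" "valid_pattern p"
    using valid_pattern_pattern[OF u(1)] u(2) by (auto simp: successively_append_iff)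
  have k: "twist Sc False k = k" "parity Sc k" "distinct_adj k" "pattern k = p" "last k = Some Sc" "k \<noteq> []"
    using canonical_fixed[OF p(1,2) vp(2)] p by (auto simp: k_def)
  let ?a = "k @ [Some Sa]" and ?b = "k @ [Some Sb]"
  \<comment> \<open>As \<open>k\<close> ends in \<open>Sc\<close>, which must not be repeated, only
    the extensions \<open>?a\<close> and \<open>?b\<close> remain up to linkage.\<close>
  have ab: "linked w ?a \<or> linked w ?b" if w: "distinct_adj w" "pattern w = p @ [False]" for w
  proof -
    obtain w1 q where q: "w = w1 @ [Some q]"
      using w(2) by (cases w rule: rev_cases) auto
    then have w1: "distinct_adj w1" "pattern w1 = p"
      using w by (auto simp: distinct_adj_append_iff)
    then obtain f where "linked w (k @ [Some (f q)])"
      using linked_append_Some[OF IH[OF w1(1) k(3) w1(2) k(4)]] q by blast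
    moreover from this have "f q \<noteq> Sc"
      using linked_distinct_adj w(1) k(5,6) by (force simp: distinct_adj_append_iff)
    ultimately show ?thesis
      by (cases "f q") auto
  qed
  have swap: "swap_word Sc (twist Sc True w) = twist Sc False w" for w
    using twist_Not[of Sc True w] by simp
  have "linked ?a ?b"
  proof -
    have "swap_word Sc (twist Sc True ?a) = ?b" "swap_word Sc (twist Sc True ?b) = ?a"
      unfolding swap by (simp_all add: twist_append k)
    then have a: "linked ?b (swap_word Sc ?a)" and b: "linked ?a (swap_word Sc ?b)"
      by (metis linked_twist swap_word_swap_word)+
    define w where "w = canonical (p @ [False])"
    have w: "twist Sc False w = w" "distinct_adj w" "pattern w = p @ [False]"
      using canonical_fixed[of "p @ [False]"] vp p by (auto simp: w_def)
    have ww: "linked w (swap_word Sc w)"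
      by (metis linked_twist swap swap_word_swap_word w(1))
    from ab[OF w(2,3)] show ?thesis
    proof
      assume wa: "linked w ?a"
      then show ?thesis
        using linked_swap_word[OF wa, of Sc] ww a by (meson linked_sym linked_trans)
    next
      assume wb: "linked w ?b"
      then show ?thesis
        using linked_swap_word[OF wb, of Sc] ww b by (meson linked_sym linked_trans)
    qed
  qed
  then show ?thesis
    using ab[OF u] ab[OF v] by (meson linked_sym linked_trans)
qed

text \<open>If the three extensions of \<open>w\<close> by \<open>None\<close> and a state are not all linked, then one of them is
  isolated. The isolated state is equivariant under letterwise permutations, but, as a function of
  the reversed word, it is constant on the classes, which contain all words of a given pattern.\<close>

definition lonely :: "state option list \<Rightarrow> state \<Rightarrow> bool" where
  "lonely w d \<longleftrightarrow>
    (\<forall>y z. linked (w @ [None, Some y]) (w @ [None, Some z]) \<longleftrightarrow> (y = d \<longleftrightarrow> z = d))"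

lemma lonely_unique:
  assumes "lonely w d" "lonely w e"
  shows "d = e"
proof (rule ccontr)
  assume "d \<noteq> e"
  then obtain f where f: "f \<noteq> d" "f \<noteq> e"
    by (cases d; cases e) (use state.distinct in blast)+
  then have "linked (w @ [None, Some f]) (w @ [None, Some e])"
    using assms(1)[unfolded lonely_def, rule_format, of f e] \<open>d \<noteq> e\<close> by blast
  then show False
    using assms(2)[unfolded lonely_def, rule_format, of f e] f by simp
qed

lemma linked_cong:
  assumes "linked a a'" "linked b b'"
  shows "linked a b \<longleftrightarrow> linked a' b'"
  using assms linked_sym linked_trans by blast

lemma lonely_transport:
  assumes "lonely w d" "\<And>y. linked (w @ [None, Some y]) (w' @ [None, Some (f y)])" "bij f"
  shows "lonely w' (f d)"
  unfolding lonely_def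
proof (intro allI)
  fix y z
  obtain y' z' where yz: "y = f y'" "z = f z'"
    using assms(3) by (metis bij_pointE)
  have "linked (w' @ [None, Some y]) (w' @ [None, Some z]) \<longleftrightarrow>
    linked (w @ [None, Some y']) (w @ [None, Some z'])"
    unfolding yz by (rule sym, rule linked_cong; rule assms(2))
  also have "\<dots> \<longleftrightarrow> (y' = d \<longleftrightarrow> z' = d)"
    using assms(1) by (simp add: lonely_def)
  also have "\<dots> \<longleftrightarrow> (y = f d \<longleftrightarrow> z = f d)"
    using assms(3) by (simp add: yz bij_is_inj inj_eq)
  finally show "linked (w' @ [None, Some y]) (w' @ [None, Some z]) \<longleftrightarrow> (y = f d \<longleftrightarrow> z = f d)" .
qed

lemma lonely_swap_word:
  assumes "lonely w d"
  shows "lonely (swap_word p w) (exchange p d)"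
proof -
  have "linked (swap_word p w @ [None, Some y]) (swap_word p w @ [None, Some z]) \<longleftrightarrow>
    linked (w @ [None, Some (exchange p y)]) (w @ [None, Some (exchange p z)])" for y z
    using linked_swap_word[of "w @ [None, Some (exchange p y)]" "w @ [None, Some (exchange p z)]" p]
      linked_swap_word[of "swap_word p w @ [None, Some y]" "swap_word p w @ [None, Some z]" p]
    by (auto simp del: map_map)
  then show ?thesis
    using assms unfolding lonely_def by (metis exchange_exchange)
qed

lemma lonely_twist:
  assumes "lonely w d"
  shows "lonely (twist r True w) (if parity r w then exchange r d else d)"
proof -
  define f where "f = (if parity r w then exchange r else (\<lambda>y. y))"
  have "linked (w @ [None, Some y]) (twist r True w @ [None, Some (f y)])" for y
    using linked_twist[of "w @ [None, Some y]" r]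
    by (auto simp: twist_append toggles_def f_def split: if_splits)
  moreover have "bij f"
    unfolding f_def by (rule bij_if_exchange)
  ultimately have "lonely (twist r True w) (f d)"
    by (rule lonely_transport[OF assms])
  then show ?thesis
    by (auto simp: f_def)
qed

text \<open>For odd parity, reversal turns the twist into a twist followed by a letterwise exchange.
  Each of the two applies \<open>exchange r\<close> to the isolated state, so the effects cancel;
  for even parity neither occurs.\<close>

lemma lonely_rev_twist:
  assumes "lonely (rev v) d"
  shows "lonely (rev (twist r True v)) d"
proof (cases "parity r v")
  case True
  then have "rev (twist r True v) = swap_word r (twist r True (rev v))"
    using twist_Not[of r True "rev v"] by (simp add: rev_twist)
  then show ?thesis
    using lonely_swap_word[OF lonely_twist[OF assms, of r], of r] True by simp
next
  case False
  then show ?thesis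
    using lonely_twist[OF assms, of r] by (simp add: rev_twist)
qed

lemma lonely_rev_linked:
  assumes "linked u v" "lonely (rev u) d"
  shows "lonely (rev v) d"
  using assms by (induction rule: linked_induct) (auto intro: lonely_rev_twist)

lemma linked_extend_None_state:
  assumes IH: "\<And>u v. distinct_adj u \<Longrightarrow> distinct_adj v \<Longrightarrow> pattern u = p \<Longrightarrow> pattern v = p \<Longrightarrow> linked u v"
    and IH': "\<And>u v. distinct_adj u \<Longrightarrow> distinct_adj v \<Longrightarrow> pattern u = rev p \<Longrightarrow> pattern v = rev p \<Longrightarrow> linked u v"
    and p: "p \<noteq> []" "\<not> last p" "\<not> hd p"
    and u: "distinct_adj u" "pattern u = p @ [True, False]"
    and v: "distinct_adj v" "pattern v = p @ [True, False]"
  shows "linked u v"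
proof (rule ccontr)
  assume not_linked: "\<not> linked u v"
  \<comment> \<open>Reversal turns a word of odd parity fixed by \<open>twist Sc False\<close> into
    one fixed by \<open>twist Sc True\<close>, hence the canonical word of the reversed
    pattern.\<close>
  define m where "m = canonical (rev p)"
  define k where "k = rev m"
  have "valid_pattern p"
    using valid_pattern_pattern[OF u(1)] u(2) by (auto simp: successively_append_iff)
  then have "valid_pattern (rev p)"
    by (simp only: successively_rev conj_commute)
  then have m: "twist Sc False m = m" "parity Sc m" "distinct_adj m" "pattern m = rev p"
    using canonical_fixed[of "rev p"] p by (auto simp: m_def hd_rev last_rev)
  then have k: "twist Sc True k = k" "parity Sc k" "distinct_adj k" "pattern k = p"
    using rev_twist[of Sc False m] by (auto simp: k_def)
  \<comment> \<open>Starting odd, the parity is even after \<open>k\<close> and odd again after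
    \<open>None\<close>, so this twist fixes \<open>k\<close> and exchanges \<open>Sa\<close> with
    \<open>Sb\<close> at the end.\<close>
  have ab: "linked (k @ [None, Some Sa]) (k @ [None, Some Sb])"
    using linked_twist[of "k @ [None, Some Sa]" Sc] by (simp add: twist_append k toggles_def)
  have transport: "\<exists>f. bij f \<and> (\<forall>y. linked (w @ [None, Some y]) (k @ [None, Some (f y)]))"
    if "distinct_adj w" "pattern w = p" for w
    using linked_append_Some[OF linked_append_None[OF IH[OF that(1) k(3) that(2) k(4)]]] by simp
  have reach: "\<exists>y. linked w (k @ [None, Some y])" if w: "distinct_adj w" "pattern w = p @ [True, False]" for w
  proof -
    obtain w1 q2 q where "w = w1 @ [q2, q]" "pattern w1 = p" "q2 = None" "q \<noteq> None"
      using w(2) unfolding pattern_def by (auto simp: map_eq_append_conv)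
    then show ?thesis
      using transport[of w1] w(1) by (auto simp: distinct_adj_append_iff)
  qed
  \<comment> \<open>Otherwise all three extensions would be linked, and then \<open>u\<close> and
    \<open>v\<close> as well.\<close>
  have ac: "\<not> linked (k @ [None, Some Sa]) (k @ [None, Some Sc])"
  proof
    assume ac: "linked (k @ [None, Some Sa]) (k @ [None, Some Sc])"
    then have "linked (k @ [None, Some Sa]) (k @ [None, Some y])" for y
      using ab by (cases y) auto
    then show False
      using reach[OF u] reach[OF v] not_linked linked_trans linked_sym by metis
  qed
  moreover from this have "\<not> linked (k @ [None, Some Sb]) (k @ [None, Some Sc])"
    using ab linked_trans by blast
  ultimately have "linked (k @ [None, Some y]) (k @ [None, Some z]) \<longleftrightarrow> (y = Sc \<longleftrightarrow> z = Sc)" for y z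
    using ab linked_sym by (cases y; cases z) auto
  then have "lonely k Sc"
    by (simp add: lonely_def)
  \<comment> \<open>The word \<open>swap_word Sa m\<close> has the pattern of \<open>m\<close>, so
    the isolated state remains \<open>Sc\<close>, whereas equivariance would turn it into
    \<open>Sb\<close>.\<close>
  moreover from this have "lonely (rev (swap_word Sa m)) Sc"
    using lonely_rev_linked[OF IH'[of m "swap_word Sa m"]] m k by (simp add: k_def)
  moreover have "rev (swap_word Sa m) = swap_word Sa k"
    by (simp add: k_def rev_map)
  ultimately show False
    using lonely_swap_word[of k Sc Sa] lonely_unique[of "swap_word Sa k" Sc Sb] by simp
qed

text \<open>Induction on the length, not on the word, since a state appended after
  \<open>None\<close> requires the claim for a reversed pattern too. A leading \<open>None\<close>
  is excluded because it makes \<open>twist r True\<close> fix the letter behind it.\<close>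

theorem linked_if_pattern_eq:
  assumes "distinct_adj u" "distinct_adj v" "pattern u = pattern v" "u = [] \<or> hd u \<noteq> None"
  shows "linked u v"
  using assms
proof (induction "length u" arbitrary: u v rule: less_induct)
  case less
  have IH: "linked u' v'" if "distinct_adj u'" "distinct_adj v'" "pattern u' = p" "pattern v' = p"
    "length p < length u" "p = [] \<or> \<not> hd p" for u' v' p
    using that less.hyps[of u' v'] by (cases u') auto
  show ?case
  proof (cases u rule: rev_cases)
    case Nil
    then show ?thesis
      using less.prems by (simp add: pattern_def)
  next
    case (snoc u1 y)
    then obtain v1 z where v: "v = v1 @ [z]"
      using less.prems(3) by (cases v rule: rev_cases) auto
    then have eqs: "pattern v1 = pattern u1" "(z = None) = (y = None)"
      and da: "distinct_adj u1" "distinct_adj v1"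
      using less.prems snoc by (auto simp: distinct_adj_append_iff)
    show ?thesis
    proof (cases "u1 = []")
      case True
      then show ?thesis
        using snoc v eqs less.prems linked_singleton by (auto simp: pattern_def)
    next
      case False
      then have hd1: "\<not> hd (pattern u1)"
        using less.prems(4) snoc by (cases u1) auto
      show ?thesis
      proof (cases "y = None")
        case True
        then show ?thesis
          using linked_append_None IH[of u1 v1 "pattern u1"] da eqs hd1 snoc v by auto
      next
        case y: False
        then have pu: "pattern u = pattern u1 @ [False]" and pv: "pattern v = pattern u1 @ [False]"
          using snoc v eqs by auto
        show ?thesis
        proof (cases "last u1 = None")
          case False
          then have "\<not> last (pattern u1)"
            using \<open>u1 \<noteq> []\<close> by (simp add: pattern_def last_map)
          then show ?thesis
            using linked_extend_state[of "pattern u1" u v] IH[of _ _ "pattern u1"] less.prems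
              pu pv hd1 \<open>u1 \<noteq> []\<close> snoc by (auto simp: pattern_def)
        next
          case True
          then obtain u2 where u2: "u1 = u2 @ [None]"
            using \<open>u1 \<noteq> []\<close> by (metis append_butlast_last_id)
          have "u2 \<noteq> []"
            using hd1 u2 by auto
          then have "last u2 \<noteq> None"
            using da u2 by (auto simp: distinct_adj_append_iff)
          then have l2: "\<not> last (pattern u2)" and h2: "\<not> hd (pattern u2)" "pattern u2 \<noteq> []"
            using \<open>u2 \<noteq> []\<close> hd1 u2 by (auto simp: pattern_def last_map hd_append)
          have "hd (rev (pattern u2)) = last (pattern u2)"
            by (simp add: hd_rev)
          then show ?thesis
            using linked_extend_None_state[of "pattern u2" u v] IH[of _ _ "pattern u2"]
              IH[of _ _ "rev (pattern u2)"] less.prems pu pv l2 h2 u2 snoc by simp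
        qed
      qed
    qed
  qed
qed


text \<open>Replacing the final \<open>Sc\<close> of the canonical word by another state flips the
  parity. Three states always leave one that differs from \<open>Sc\<close> and from the preceding
  letter.\<close>

lemma pattern_exists_parity:
  assumes p: "p \<noteq> []" "\<not> last p" "valid_pattern p"
  obtains w where "distinct_adj w" "pattern w = p" "last w \<noteq> None" "parity Sc w = b"
proof -
  note k = canonical_fixed[OF p]
  show thesis
  proof (cases "parity Sc (canonical p) = b")
    case True
    then show ?thesis
      using that k by blast
  next
    case False
    obtain u where u: "canonical p = u @ [Some Sc]"
      using k p(1) by (metis append_butlast_last_id canonical_eq_Nil)
    obtain q where q: "q \<noteq> Sc" "u = [] \<or> last u \<noteq> Some q"
      by (metis option.inject state.distinct(1,3,5))
    have "distinct_adj (u @ [Some q])" "pattern (u @ [Some q]) = p"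
      using k q u by (auto simp: distinct_adj_append_iff)
    moreover have "parity Sc (u @ [Some q]) = b"
      using False q u by (auto simp: parity_append toggles_def)
    ultimately show ?thesis
      using that[of "u @ [Some q]"] by simp
  qed
qed

text \<open>The predicate \<open>R\<close> spreads to all words of the same pattern, and these
  include one of odd parity. A final \<open>None\<close> is split off first: before it an even word
  is needed.\<close>

lemma odd_word_in_orbit:
  assumes w: "distinct_adj w" "w \<noteq> []" "R w"
    and R: "\<And>r x w. R w \<Longrightarrow> R (twist r x w)"
  obtains w' where "R w'" "parity Sc w'"
proof -
  have all: "R w'" if w': "distinct_adj w'" "pattern w' = pattern w" for w'
  proof (cases "hd w = None")
    case False
    then have "linked w w'"
      using linked_if_pattern_eq w w' by simp
    then show ?thesis
      by (induction rule: linked_induct) (use w R in auto)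
  next
    \<comment> \<open>Behind a leading \<open>None\<close>, \<open>twist r False\<close> acts as
      \<open>twist r True\<close>, so transitivity on the remaining words applies.\<close>
    case True
    then obtain w1 where w1: "w = None # w1"
      using w(2) by (cases w) auto
    obtain w2 where w2: "w' = None # w2"
      using w' w1 by (cases w') auto
    have "linked w1 w2"
      using w w' w1 w2 by (intro linked_if_pattern_eq) (auto simp: distinct_adj_Cons)
    then have "R (None # w2)"
    proof (induction rule: linked_induct)
      case refl
      then show ?case
        using w w1 by simp
    next
      case (step v r)
      then show ?case
        using R[of "None # v" r False] by (simp add: toggles_def)
    qed
    then show ?thesis
      by (simp add: w2)
  qed
  show thesis
  proof (cases "last w = None")
    case False
    then have "\<not> last (pattern w)"
      using w by (simp add: pattern_def last_map)
    then obtain v where "distinct_adj v" "pattern v = pattern w" "parity Sc v"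
      using pattern_exists_parity[of "pattern w" True] valid_pattern_pattern w
      by (metis length_0_conv pattern_simps(6))
    then show ?thesis
      using all that by blast
  next
    case True
    then obtain u where u: "w = u @ [None]"
      using w(2) by (metis append_butlast_last_id)
    show ?thesis
    proof (cases "u = []")
      case True
      then show ?thesis
        using that[of w] w u by (simp add: toggles_def)
    next
      case False
      then have "last u \<noteq> None"
        using w u by (auto simp: distinct_adj_append_iff)
      then have "\<not> last (pattern u)" "pattern u \<noteq> []" "valid_pattern (pattern u)"
        using w u False valid_pattern_pattern by (auto simp: pattern_def last_map distinct_adj_append_iff)
      then obtain v where v: "distinct_adj v" "pattern v = pattern u" "last v \<noteq> None" "\<not> parity Sc v"
        using pattern_exists_parity[of "pattern u" False] by metis
      then have "distinct_adj (v @ [None])"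
        by (auto simp: distinct_adj_append_iff)
      then show ?thesis
        using that[of "v @ [None]"] all v u by (simp add: parity_append toggles_def)
    qed
  qed
qed

section \<open>The Bellaterra automaton and the symmetries of its relators\<close>

definition bellaterra :: "(state option, bool) automaton" where
  "bellaterra = \<lparr>
     transition = (\<lambda>q x. case q of None \<Rightarrow> None
       | Some Sa \<Rightarrow> Some (if x then Sc else Sb)
       | Some Sb \<Rightarrow> Some (if x then Sb else Sc)
       | Some Sc \<Rightarrow> Some Sa),
     out = (\<lambda>q x. x \<noteq> toggles Sc q)\<rparr>"

text \<open>The cyclic permutation from \<open>Sa\<close> to \<open>Sb\<close> to \<open>Sc\<close>
  to \<open>Sa\<close>, which is the transition on the letter \<open>False\<close>. On
  \<open>True\<close> it is preceded by \<open>exchange Sc\<close>.\<close>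

abbreviation rot :: "state option list \<Rightarrow> state option list" where
  "rot w \<equiv> swap_word Sc (swap_word Sa w)"

text \<open>As \<open>fold\<close> applies factors from left to right, each factor receives the
  letter \<open>x\<close> changed by the toggles before it. This is the Boolean carried by
  \<open>twist Sc\<close>, so a section is a twist followed by \<open>rot\<close>.\<close>

lemma fold_bellaterra_Cons:
  "fold (act bellaterra) w (x # v) =
    (x \<noteq> parity Sc w) # fold (act bellaterra) (rot (twist Sc x w)) v"
proof (induction w arbitrary: x v)
  case (Cons q w)
  have "transition bellaterra q x =
    map_option (exchange Sc) (map_option (exchange Sa) (if x then map_option (exchange Sc) q else q))"
    by (auto simp: bellaterra_def split: option.split state.split)
  moreover have "((x \<noteq> toggles Sc q) \<noteq> parity Sc w) = (x \<noteq> parity Sc (q # w))"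
    by auto
  ultimately show ?case
    using Cons[of "x \<noteq> toggles Sc q" "act bellaterra (transition bellaterra q x) v"]
    by (simp add: bellaterra_def[THEN arg_cong[where f = out]] del: parity.simps)
qed simp

definition relator :: "state option list \<Rightarrow> bool" where
  "relator w \<longleftrightarrow> fold (act bellaterra) w = id"

lemma relator_parity: "relator w \<Longrightarrow> \<not> parity Sc w"
  using fold_bellaterra_Cons[of w False "[]"] by (auto simp: relator_def)

lemma relator_section:
  assumes "relator w"
  shows "relator (rot (twist Sc x w))"
proof -
  have "fold (act bellaterra) (rot (twist Sc x w)) v = v" for v
    using fold_bellaterra_Cons[of w x v] assms by (simp add: relator_def)
  then show ?thesis
    by (auto simp: relator_def)
qed

text \<open>Taking a section preserves the length and is injective. On the finite set of relators of
  a given length it is therefore a permutation, which yields the converse implication.\<close>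

lemma relator_section_iff: "relator (rot (twist Sc x w)) \<longleftrightarrow> relator w"
proof -
  define R where "R = {v. relator v \<and> length v = length w}"
  define f where "f = (\<lambda>v. rot (twist Sc x v))"
  have f_eq: "u = v" if "f u = f v" for u v
    using that unfolding f_def by (metis swap_word_swap_word twist_twist)
  have "finite {v :: state option list. set v \<subseteq> UNIV \<and> length v = length w}"
    by (rule finite_lists_length_eq) simp
  then have "finite R"
    by (rule rev_finite_subset) (auto simp: R_def)
  moreover have "f ` R \<subseteq> R"
    using relator_section by (auto simp: f_def R_def)
  moreover have "inj_on f R"
    using f_eq by (auto simp: inj_on_def)
  ultimately have "f ` R = R"
    by (simp add: endo_inj_surj)
  have "relator w" if "relator (f w)"
  proof -
    have "f w \<in> R"
      using that by (simp add: R_def f_def)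
    then have "f w \<in> f ` R"
      using \<open>f ` R = R\<close> by simp
    then have "w \<in> R"
      using f_eq by blast
    then show ?thesis
      by (simp add: R_def)
  qed
  then show ?thesis
    using relator_section unfolding f_def by blast
qed

text \<open>The two sections of a word differ by a letterwise transposition, applied either before
  or after.\<close>

lemma relator_swap_word:
  assumes "relator w"
  shows "relator (swap_word r w)"
proof -
  have c: "relator (swap_word Sc w)" if "relator w" for w
  proof -
    have "twist Sc False (swap_word Sc w) = twist Sc True w"
      using swap_word_twist[of Sc Sc False w] twist_Not[of Sc False w] by simp
    then show ?thesis
      using that relator_section_iff by metis
  qed
  have a: "relator (swap_word Sa w)" if "relator w" for w
  proof -
    define u where "u = twist Sc False (swap_word Sa (swap_word Sc w))"
    have rot_inv: "rot (swap_word Sa (swap_word Sc z)) = z" for z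
      by (simp del: map_map)
    have w: "w = rot (twist Sc False u)"
      by (simp add: u_def rot_inv del: map_map)
    have "rot (swap_word Sc z) = swap_word Sa (rot z)" for z
    proof -
      have "map_option (exchange Sc) (map_option (exchange Sa) (map_option (exchange Sc) q)) =
        map_option (exchange Sa) (map_option (exchange Sc) (map_option (exchange Sa) q))" for q
        by (cases q; cases "the q") auto
      then show ?thesis
        by simp
    qed
    then have "swap_word Sa w = rot (twist Sc True u)"
      using twist_Not[of Sc False u] w by simp
    then show ?thesis
      using that w relator_section_iff by metis
  qed
  have "swap_word Sb w = swap_word Sa (swap_word Sc (swap_word Sa w))"
  proof -
    have "map_option (exchange Sb) q = map_option (exchange Sa) (map_option (exchange Sc) (map_option (exchange Sa) q))" for q
      by (cases q; cases "the q") auto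
    then show ?thesis
      by simp
  qed
  then show ?thesis
    using assms a c by (cases r) metis+
qed

text \<open>For \<open>Sc\<close>, undo \<open>rot\<close> in a section by letterwise exchanges; the
  other twists are conjugate to this one.\<close>

lemma relator_twist:
  assumes "relator w"
  shows "relator (twist r x w)"
proof -
  have c: "relator (twist Sc x w)" if "relator w" for w
    using relator_section[OF that, of x] relator_swap_word[of _ Sc] relator_swap_word[of _ Sa]
      swap_word_swap_word by metis
  obtain p where p: "exchange p Sc = r" "exchange p r = Sc"
    by (metis state.exhaust exchange.simps(2,4,6) exchange_exchange exchange_same)
  have "twist r x w = swap_word p (twist Sc x (swap_word p w))"
    using swap_word_twist[of p Sc x "swap_word p w"] p by (simp del: map_map)
  then show ?thesis
    using assms c relator_swap_word by metis
qed

text \<open>The twists of a relator are relators, but one of them would have odd parity and so move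
  the first letter of the tree.\<close>

theorem not_relator:
  assumes "distinct_adj w" "w \<noteq> []"
  shows "\<not> relator w"
proof
  assume "relator w"
  from odd_word_in_orbit[OF assms this relator_twist] relator_parity show False
    by metis
qed

section \<open>Words in the states of an automaton\<close>

definition letter_act :: "('q, 'x) automaton \<Rightarrow> 'q \<times> bool \<Rightarrow> 'x list \<Rightarrow> 'x list" where
  "letter_act A l = act (if snd l then A else inverse_automaton A) (fst l)"

text \<open>The rightmost letter acts first, opposite to the \<open>fold\<close> used for the
  Bellaterra automaton; words are reversed when passing between the two.\<close>

fun word_act :: "('q, 'x) automaton \<Rightarrow> ('q \<times> bool) list \<Rightarrow> 'x list \<Rightarrow> 'x list" where
  "word_act A [] = id"
| "word_act A (l # w) = letter_act A l \<circ> word_act A w"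

lemma tree_Aut_simps [simp]:
  "f \<otimes>\<^bsub>tree_Aut\<^esub> g = f \<circ> g" "\<one>\<^bsub>tree_Aut\<^esub> = id"
  by (simp_all add: tree_Aut_def)

lemma automaton_group_simps [simp]:
  "f \<otimes>\<^bsub>automaton_group A\<^esub> g = f \<circ> g" "\<one>\<^bsub>automaton_group A\<^esub> = id"
  by (simp_all add: automaton_group_def subgroup_generated_def)

lemma word_act_append: "word_act A (u @ v) = word_act A u \<circ> word_act A v"
  by (induction u) auto

lemma letter_act_inv_letter:
  assumes "invertible_automaton A"
  shows "letter_act A l (letter_act A (inv_letter l) v) = v"
    and "letter_act A (inv_letter l) (letter_act A l v) = v"
  using act_inverse_automaton[OF assms] by (auto simp: letter_act_def inv_letter_def)

lemma word_act_reduced_cons: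
  assumes "invertible_automaton A"
  shows "word_act A (reduced_cons l w) = letter_act A l \<circ> word_act A w"
  by (cases w) (auto simp: fun_eq_iff letter_act_inv_letter[OF assms])

lemma word_act_foldr_reduced_cons:
  assumes "invertible_automaton A"
  shows "word_act A (foldr reduced_cons u v) = word_act A u \<circ> word_act A v"
  by (induction u) (auto simp: word_act_reduced_cons[OF assms])

definition inverse_word :: "('a \<times> bool) list \<Rightarrow> ('a \<times> bool) list" where
  "inverse_word w = rev (map inv_letter w)"

lemma word_act_inverse_word:
  assumes "invertible_automaton A"
  shows "word_act A (inverse_word w) (word_act A w v) = v"
    and "word_act A w (word_act A (inverse_word w) v) = v"
proof -
  show "word_act A (inverse_word w) (word_act A w v) = v"
    by (induction w arbitrary: v)
      (auto simp: inverse_word_def word_act_append letter_act_inv_letter[OF assms])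
  show "word_act A w (word_act A (inverse_word w) v) = v"
    by (induction w arbitrary: v)
      (auto simp: inverse_word_def word_act_append letter_act_inv_letter[OF assms])
qed

lemma invertible_inverse_automaton:
  "invertible_automaton A \<Longrightarrow> invertible_automaton (inverse_automaton A)"
  by (simp add: invertible_automaton_def inverse_automaton_def bij_imp_bij_inv)

lemma inv_act:
  assumes "invertible_automaton A"
  shows "inv\<^bsub>tree_Aut\<^esub> act A q = act (inverse_automaton A) q"
  by (rule group.inv_equality[OF group_tree_Aut])
    (auto simp: fun_eq_iff act_inverse_automaton[OF assms] intro: act_in_tree_Aut assms
      invertible_inverse_automaton)

lemma carrier_automaton_group_generate:
  assumes "invertible_automaton A"
  shows "carrier (automaton_group A) = generate tree_Aut (range (act A))"
proof -
  have "carrier tree_Aut \<inter> range (act A) = range (act A)"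
    using act_in_tree_Aut[OF assms] by auto
  then show ?thesis
    by (simp add: automaton_group_def subgroup_generated_def)
qed

lemma carrier_automaton_group:
  assumes A: "invertible_automaton A"
  shows "carrier (automaton_group A) = range (word_act A)"
proof -
  have letter: "letter_act A l \<in> generate tree_Aut (range (act A))" for l
    using generate.incl[of "act A (fst l)" "range (act A)" tree_Aut]
      generate.inv[of "act A (fst l)" "range (act A)" tree_Aut]
    by (auto simp: letter_act_def inv_act[OF A])
  have "f \<in> range (word_act A)" if "f \<in> generate tree_Aut (range (act A))" for f
    using that
  proof induction
    case one
    then show ?case
      by (auto intro!: range_eqI[of _ _ "[]"])
  next
    case (incl h)
    then obtain q where "h = word_act A [(q, True)]"
      by (auto simp: letter_act_def)
    then show ?case
      by blast
  next
    case (inv h)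
    then obtain q where "inv\<^bsub>tree_Aut\<^esub> h = word_act A [(q, False)]"
      by (auto simp: letter_act_def inv_act[OF A])
    then show ?case
      by (metis rangeI)
  next
    case (eng f g)
    then obtain u v where "f = word_act A u" "g = word_act A v"
      by blast
    then have "f \<otimes>\<^bsub>tree_Aut\<^esub> g = word_act A (u @ v)"
      by (simp add: word_act_append)
    then show ?case
      by (metis rangeI)
  qed
  moreover have "word_act A w \<in> generate tree_Aut (range (act A))" for w
  proof (induction w)
    case Nil
    then show ?case
      using generate.one[of tree_Aut "range (act A)"] by (simp add: id_def)
  next
    case (Cons l w)
    then show ?case
      using generate.eng[OF letter[of l] Cons] by (simp add: comp_def)
  qed
  ultimately show ?thesis
    using carrier_automaton_group_generate[OF A] by blast
qed

lemma inv_word_act: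
  assumes A: "invertible_automaton A"
  shows "inv\<^bsub>automaton_group A\<^esub> word_act A w = word_act A (inverse_word w)"
  by (rule group.inv_equality[OF group_automaton_group])
    (auto simp: fun_eq_iff word_act_inverse_word[OF A] carrier_automaton_group[OF A])

text \<open>The hypothesis makes the kernel trivial. Surjectivity holds because every element is the
  action of a word, which free reduction does not change.\<close>

lemma free_group_iso_automaton_group:
  fixes A :: "('q, 'x) automaton"
  assumes A: "invertible_automaton A"
    and free: "\<And>w. reduced_word w \<Longrightarrow> word_act A w = id \<Longrightarrow> w = []"
  shows "free_group (UNIV :: 'q set) \<cong> automaton_group A"
proof -
  let ?F = "free_group (UNIV :: 'q set)" and ?G = "automaton_group A"
  interpret F: group ?F by (rule group_free_group)
  interpret G: group ?G by (rule group_automaton_group)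
  have hom: "word_act A \<in> hom ?F ?G"
    by (rule homI) (auto simp: carrier_automaton_group[OF A] word_act_foldr_reduced_cons[OF A])
  interpret group_hom ?F ?G "word_act A"
    by unfold_locales (rule hom)
  have "inj_on (word_act A) (carrier ?F)"
    by (rule inj_on_one_iff[THEN iffD2]) (use free in auto)
  moreover have "word_act A ` carrier ?F = carrier ?G"
  proof
    show "carrier ?G \<subseteq> word_act A ` carrier ?F"
    proof
      fix f assume "f \<in> carrier ?G"
      then obtain w where "f = word_act A w"
        using carrier_automaton_group[OF A] by auto
      then have "f = word_act A (foldr reduced_cons w [])"
        by (simp add: word_act_foldr_reduced_cons[OF A])
      moreover have "reduced_word (foldr reduced_cons w [])"
        by (rule reduced_word_foldr) (simp add: reduced_word_def)
      ultimately show "f \<in> word_act A ` carrier ?F"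
        by simp
    qed
  qed (use hom in \<open>auto simp: hom_def\<close>)
  ultimately have "word_act A \<in> iso ?F ?G"
    using hom by (simp add: iso_def bij_betw_def)
  then show ?thesis
    by (auto simp: is_iso_def)
qed

lemma free_group_iso:
  fixes e :: "'a \<Rightarrow> 'b"
  assumes "bij_betw e S T"
  shows "free_group S \<cong> free_group T"
proof -
  let ?h = "map (apfst e)"
  have inj: "inj_on e S" and surj: "e ` S = T"
    using assms by (auto simp: bij_betw_def)
  have inv: "inv_letter (apfst e x) = apfst e (inv_letter x)" for x
    by (auto simp: inv_letter_def apfst_def map_prod_def split: prod.split)
  have eq: "apfst e y = apfst e x \<longleftrightarrow> y = x" if "fst x \<in> S" "fst y \<in> S" for x y :: "'a \<times> bool"
    using that inj by (auto simp: inj_on_def prod_eq_iff)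
  have fst_inv: "fst (inv_letter x) = fst x" for x :: "'a \<times> bool"
    by (simp add: inv_letter_def)
  have cons: "?h (reduced_cons x w) = reduced_cons (apfst e x) (?h w)"
    if "fst x \<in> S" "fst ` set w \<subseteq> S" for x w
    using that eq[of "inv_letter x"] by (cases w) (auto simp: inv fst_inv)
  have hom: "?h (foldr reduced_cons u v) = foldr reduced_cons (?h u) (?h v)"
    if "fst ` set u \<subseteq> S" "fst ` set v \<subseteq> S" for u v
    using that
  proof (induction u)
    case (Cons x u)
    have "fst ` set (foldr reduced_cons u v) \<subseteq> S"
      using Cons.prems set_foldr_reduced_cons[of u v] by fastforce
    then have "?h (reduced_cons x (foldr reduced_cons u v)) =
        reduced_cons (apfst e x) (?h (foldr reduced_cons u v))"
      using Cons.prems by (intro cons) auto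
    also have "?h (foldr reduced_cons u v) = foldr reduced_cons (?h u) (?h v)"
      using Cons by simp
    finally show ?case
      by simp
  qed simp
  have red: "reduced_word (?h w) \<longleftrightarrow> reduced_word w" if "fst ` set w \<subseteq> S" for w
    using that
  proof (induction w)
    case (Cons x w)
    then show ?case
      using eq[of "inv_letter x"]
      by (cases w) (auto simp: reduced_word_def inv fst_inv)
  qed (simp add: reduced_word_def)
  have "?h \<in> hom (free_group S) (free_group T)"
    by (rule homI) (use surj red in \<open>auto simp: hom\<close>)
  moreover have "inj_on ?h (carrier (free_group S))"
  proof (rule inj_onI)
    fix u v assume uv: "u \<in> carrier (free_group S)" "v \<in> carrier (free_group S)" "?h u = ?h v"
    have "fst x \<in> S" if "x \<in> set u \<union> set v" for x
      using uv that by auto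
    then have "inj_on (apfst e) (set u \<union> set v)"
      using eq by (intro inj_onI) blast
    then show "u = v"
      using uv(3) by (metis map_inj_on)
  qed
  moreover have "?h ` carrier (free_group S) = carrier (free_group T)"
  proof
    show "?h ` carrier (free_group S) \<subseteq> carrier (free_group T)"
      using surj red by fastforce
    show "carrier (free_group T) \<subseteq> ?h ` carrier (free_group S)"
    proof
      fix w assume w: "w \<in> carrier (free_group T)"
      define v where "v = map (apfst (inv_into S e)) w"
      have mem: "fst p \<in> e ` S" if "p \<in> set w" for p
        using w surj that by auto
      have "fst ` set v \<subseteq> S"
        using mem by (auto simp: v_def inv_into_into)
      moreover have "?h v = w"
        unfolding v_def map_map
        by (rule map_idI) (use mem in \<open>auto simp: f_inv_into_f prod_eq_iff\<close>)
      ultimately show "w \<in> ?h ` carrier (free_group S)"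
        using w red by (auto intro!: image_eqI[of _ _ v])
    qed
  qed
  ultimately show ?thesis
    by (auto simp: is_iso_def iso_def bij_betw_def)
qed

section \<open>Symmetric automata\<close>

lemma invertible_rename_states:
  "invertible_automaton A \<Longrightarrow> invertible_automaton (rename_states f A)"
  by (simp add: invertible_automaton_def rename_states_def)

lemma automaton_group_rename_states:
  assumes f: "bij f"
  shows "automaton_group (rename_states f A) = automaton_group A"
proof -
  have "act (rename_states f A) (f q) v = act A q v" for q v
    by (induction v arbitrary: q) (auto simp: rename_states_def bij_is_inj[OF f])
  then have "act (rename_states f A) \<circ> f = act A"
    by (simp add: fun_eq_iff)
  then have "range (act (rename_states f A)) = range (act A)"
    by (metis bij_is_surj f image_comp)
  then show ?thesis
    by (simp add: automaton_group_def)
qed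

lemma automaton_group_inverse_automaton:
  fixes A :: "('b, 'a) automaton"
  assumes A: "invertible_automaton A"
  shows "automaton_group (inverse_automaton A) = automaton_group A"
proof -
  interpret group "tree_Aut :: ('a list \<Rightarrow> 'a list) monoid"
    by (rule group_tree_Aut)
  note B = invertible_inverse_automaton[OF A]
  have "act (inverse_automaton (inverse_automaton A)) q = act A q" for q
    by (metis A B act_in_tree_Aut inv_act inv_inv)
  then have "letter_act (inverse_automaton A) l = letter_act A (inv_letter l)" for l
    by (simp add: letter_act_def inv_letter_def)
  then have "word_act (inverse_automaton A) w = word_act A (map inv_letter w)" for w
    by (induction w) auto
  then have "word_act (inverse_automaton A) = word_act A \<circ> map inv_letter"
    by (simp add: fun_eq_iff)
  moreover have "surj (map (inv_letter :: 'b \<times> bool \<Rightarrow> _))"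
    by (intro surjI[of _ "map inv_letter"]) (simp add: comp_def)
  ultimately have "range (word_act (inverse_automaton A)) = range (word_act A)"
    by (metis image_comp)
  then show ?thesis
    using carrier_automaton_group[OF A] carrier_automaton_group[OF B]
    by (simp add: automaton_group_def subgroup_generated_def)
qed

lemma invertible_rename_letters:
  assumes "invertible_automaton A" "bij g"
  shows "invertible_automaton (rename_letters g A)"
proof -
  have "bij (g \<circ> out A q \<circ> inv_into UNIV g)" for q
    using assms by (auto simp: invertible_automaton_def intro!: bij_comp bij_imp_bij_inv)
  then show ?thesis
    by (simp add: invertible_automaton_def rename_letters_def comp_def)
qed

text \<open>The isomorphism is conjugation by the letterwise renaming of tree words.\<close>

lemma automaton_group_rename_letters:
  assumes A: "invertible_automaton A" and g: "bij g"
  shows "automaton_group A \<cong> automaton_group (rename_letters g A)"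
proof -
  define B where "B = rename_letters g A"
  have B: "invertible_automaton B"
    unfolding B_def by (rule invertible_rename_letters[OF A g])
  define h where "h = (\<lambda>f. map g \<circ> f \<circ> map (inv_into UNIV g))"
  have inv1: "map (inv_into UNIV g) (map g v) = v" and inv2: "map g (map (inv_into UNIV g) w) = w" for v w
    by (auto simp: bij_is_inj[OF g] surj_f_inv_f[OF bij_is_surj[OF g]] intro: map_idI)
  have h_comp: "h (f \<circ> f') = h f \<circ> h f'" for f f'
    by (simp add: h_def fun_eq_iff inv1 del: map_map)
  have act: "act B q v = map g (act A q (map (inv_into UNIV g) v))" for q v
    by (induction v arbitrary: q) (auto simp: B_def rename_letters_def)
  have "act (inverse_automaton B) q v = map g (act (inverse_automaton A) q (map (inv_into UNIV g) v))"
    for q v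
  proof -
    have "act B q (map g (act (inverse_automaton A) q (map (inv_into UNIV g) v))) = v"
      by (simp add: act inv1 inv2 act_inverse_automaton[OF A] del: map_map)
    then show ?thesis
      by (metis act_inverse_automaton(1)[OF B])
  qed
  then have "letter_act B l = h (letter_act A l)" for l
    by (auto simp: letter_act_def h_def act)
  then have word: "word_act B w = h (word_act A w)" for w
  proof (induction w)
    case Nil
    show ?case
      by (simp add: h_def fun_eq_iff inv2 del: map_map)
  qed (simp add: h_comp)
  have "h \<in> hom (automaton_group A) (automaton_group B)"
    by (rule homI) (auto simp: carrier_automaton_group[OF A] carrier_automaton_group[OF B] h_comp
      word[symmetric])
  moreover have "inj h"
  proof (rule injI)
    fix f f' assume "h f = h f'"
    then have "map (inv_into UNIV g) (h f (map g v)) = map (inv_into UNIV g) (h f' (map g v))" for v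
      by simp
    then show "f = f'"
      by (simp add: h_def inv1 fun_eq_iff del: map_map)
  qed
  moreover have "h ` carrier (automaton_group A) = carrier (automaton_group B)"
    by (simp add: carrier_automaton_group[OF A] carrier_automaton_group[OF B] image_image
      word[symmetric])
  ultimately show ?thesis
    unfolding B_def[symmetric] is_iso_def iso_def bij_betw_def
    by (auto intro: inj_on_subset)
qed

lemma symmetry_step_iso:
  assumes "symmetry_step A B" "invertible_automaton A"
  shows "invertible_automaton B \<and> automaton_group A \<cong> automaton_group B"
  using assms
proof induction
  case (states f A)
  then show ?case
    using iso_refl by (auto simp: automaton_group_rename_states invertible_rename_states is_iso_def)
next
  case (letters g A)
  then show ?case
    using automaton_group_rename_letters invertible_rename_letters by blast
next
  case (inverse A)
  then show ?case
    using iso_refl by (auto simp: automaton_group_inverse_automaton invertible_inverse_automaton is_iso_def)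
qed

lemma symmetry_steps_iso:
  assumes "symmetry_step\<^sup>*\<^sup>* A B" "invertible_automaton A"
  shows "invertible_automaton B \<and> automaton_group A \<cong> automaton_group B"
  using assms
proof (induction rule: rtranclp_induct)
  case base
  then show ?case
    using iso_refl by (auto simp: is_iso_def)
next
  case (step B C)
  then show ?case
    using symmetry_step_iso iso_trans by blast
qed

lemma rename_iso:
  assumes "invertible_automaton A" "bij f" "bij g"
  shows "invertible_automaton (rename_states f (rename_letters g A)) \<and>
    automaton_group A \<cong> automaton_group (rename_states f (rename_letters g A))"
  using assms
  by (simp add: automaton_group_rename_states automaton_group_rename_letters
      invertible_rename_states invertible_rename_letters)

lemma symmetric_automata_iso:
  assumes "symmetric_automata A B" "invertible_automaton A"
  shows "automaton_group A \<cong> automaton_group B"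
  using assms rename_iso symmetry_steps_iso iso_trans unfolding symmetric_automata_def by meson

section \<open>Deciding words by their sections\<close>

text \<open>In \<open>(s, r0, r1)\<close>, \<open>s\<close> says whether the output is the
  transposition; \<open>r0\<close> and \<open>r1\<close> are the successors at \<open>False\<close>
  and \<open>True\<close>. Such concrete data can be evaluated.\<close>

type_synonym entry = "bool \<times> state \<times> state"
type_synonym code = "entry \<times> entry \<times> entry"

fun entry :: "code \<Rightarrow> state \<Rightarrow> entry" where
  "entry (ea, eb, ec) Sa = ea"
| "entry (ea, eb, ec) Sb = eb"
| "entry (ea, eb, ec) Sc = ec"

text \<open>The Boolean \<open>e\<close> distinguishes a state from its inverse. The section of an
  inverse is taken at the preimage of the letter, which interchanges \<open>r0\<close> and
  \<open>r1\<close> for active states.\<close>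

fun letter_section :: "entry \<Rightarrow> bool \<Rightarrow> bool \<Rightarrow> (state \<times> bool) \<times> bool" where
  "letter_section (False, r0, r1) e False = ((r0, e), False)"
| "letter_section (False, r0, r1) e True = ((r1, e), True)"
| "letter_section (True, r0, r1) True False = ((r0, True), True)"
| "letter_section (True, r0, r1) True True = ((r1, True), False)"
| "letter_section (True, r0, r1) False False = ((r1, False), True)"
| "letter_section (True, r0, r1) False True = ((r0, False), False)"

text \<open>Free reduction does not change the action and lets more sections coincide with words
  already met.\<close>

fun cons_section ::
  "code \<Rightarrow> state \<times> bool \<Rightarrow> (state \<times> bool) list \<times> bool \<Rightarrow> (state \<times> bool) list \<times> bool" where
  "cons_section C (q, e) (w, y) =
    (case letter_section (entry C q) e y of (l, z) \<Rightarrow> (reduced_cons l w, z))"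

fun word_section :: "code \<Rightarrow> (state \<times> bool) list \<Rightarrow> bool \<Rightarrow> (state \<times> bool) list \<times> bool" where
  "word_section C [] x = ([], x)"
| "word_section C (l # w) x = cons_section C l (word_section C w x)"

text \<open>\<open>None\<close> means that the fuel is exhausted. Here and below, \<open>if\<close> replaces the
  propositional connectives, whose arguments the simplifier would all evaluate.\<close>

fun decide ::
  "nat \<Rightarrow> code \<Rightarrow> (state \<times> bool) list list \<Rightarrow> (state \<times> bool) list list \<Rightarrow> bool option" where
  "decide 0 C seen todo = None"
| "decide (Suc n) C seen [] = Some True"
| "decide (Suc n) C seen (w # todo) =
    (if w = [] then decide n C seen todo
     else if w \<in> set seen then decide n C seen todo
     else case word_section C w False of (u, y) \<Rightarrow>
       if y then Some False
       else decide n C (w # seen) (u # fst (word_section C w True) # todo))"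

text \<open>The fuel only limits the search: an answer other than \<open>None\<close> is correct for
  every amount of it.\<close>

definition is_trivial where
  "is_trivial n C w \<longleftrightarrow> decide n C [] [w] = Some True"

definition is_nontrivial where
  "is_nontrivial C w \<longleftrightarrow> decide 40 C [] [w] = Some False"

definition commutator_word where
  "commutator_word u v = u @ v @ inverse_word u @ inverse_word v"

abbreviation (input) "pa \<equiv> (Sa, True)"
abbreviation (input) "na \<equiv> (Sa, False)"
abbreviation (input) "pb \<equiv> (Sb, True)"
abbreviation (input) "nb \<equiv> (Sb, False)"
abbreviation (input) "pc \<equiv> (Sc, True)"
abbreviation (input) "nc \<equiv> (Sc, False)"

definition commuting_states where
  "commuting_states C \<longleftrightarrow>
    (if is_trivial 40 C (commutator_word [pa] [pb])
     then if is_trivial 40 C (commutator_word [pa] [pc])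
       then is_trivial 40 C (commutator_word [pb] [pc]) else False
     else False)"

fun find_involution where
  "find_involution C [] = False"
| "find_involution C (u # us) =
    (if (if is_nontrivial C u then is_trivial 20 C (u @ u) else False) then True
     else find_involution C us)"

fun find_commuting_conjugate where
  "find_commuting_conjugate n C [] = False"
| "find_commuting_conjugate n C ((u, l) # us) =
    (if (if is_trivial n C (commutator_word u (l # u @ [inv_letter l]))
         then is_nontrivial C (commutator_word u [l]) else False) then True
     else find_commuting_conjugate n C us)"

text \<open>The words were found by a computer search. Those in \<open>long_conjugate_words\<close> need many sections and
  are tried last.\<close>

definition involution_words :: "(state \<times> bool) list list" where
  "involution_words =
    [[pa], [nc, pa], [nc, pb], [nb, pa], [pb], [na, pb, pb], [nb, pa, pa]]"

definition conjugate_words :: "((state \<times> bool) list \<times> (state \<times> bool)) list" where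
  "conjugate_words =
    [([nb, pa], pa), ([nc, nb, pc, pb], pa), ([na, pc, na, pb], pa), ([nb, pc, na, pc], pa),
     ([nc, pb], pa), ([na, nc, pa, pc], pa), ([na, nb, pc, pc], pb), ([pa, nb, na, pc], pa),
     ([nb, na, pc, pc], pa), ([pa, nc, na, pb], pa)]"

definition long_conjugate_words :: "((state \<times> bool) list \<times> (state \<times> bool)) list" where
  "long_conjugate_words =
    [([nc, pa], pa), ([nb, pa, pa, pa], pa), ([na, pb, pb, pb], pb), ([na, pb, pa, pb], pb),
     ([nb, pa, pb, pa], pa), ([na, nc, pa, pc], pa), ([nb, nc, pb, pc], pb)]"

text \<open>The two excepted codes are the Aleshin-Vorobets automaton and an automaton symmetric to
  it; their group is free, so no certificate can exist.\<close>

definition classify where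
  "classify C \<longleftrightarrow>
    (if commuting_states C then True
     else if find_involution C involution_words then True
     else if find_commuting_conjugate 8 C conjugate_words then True
     else if C \<in> set [((True, Sb, Sc), (True, Sc, Sb), (False, Sa, Sa)),
         ((True, Sa, Sc), (True, Sc, Sa), (False, Sb, Sb))]
       then True
     else find_commuting_conjugate 130 C long_conjugate_words)"

definition entries :: "bool \<Rightarrow> entry list" where
  "entries s = [(s, Sa, Sa), (s, Sa, Sb), (s, Sa, Sc), (s, Sb, Sb), (s, Sb, Sc), (s, Sc, Sc),
     (s, Sb, Sa), (s, Sc, Sa), (s, Sc, Sb)]"

text \<open>Renaming the letters reverses all entries and inversion reverses the entries with output
  \<open>Not\<close>, so one active and one inactive entry can be normalised simultaneously.\<close>

definition half_entries :: "bool \<Rightarrow> entry list" where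
  "half_entries s = [(s, Sa, Sa), (s, Sa, Sb), (s, Sa, Sc), (s, Sb, Sb), (s, Sb, Sc), (s, Sc, Sc)]"

lemma classify_one_active:
  "list_all (\<lambda>f. list_all (\<lambda>g. list_all (\<lambda>e. classify (e, f, g)) (half_entries True))
    (entries False)) (half_entries False)"
  by code_simp

lemma classify_two_active:
  "list_all (\<lambda>f. list_all (\<lambda>g. list_all (\<lambda>e. classify (e, f, g)) (half_entries True))
    (half_entries False)) (entries True)"
  by code_simp

text \<open>Without inactive states, inversion and renaming the letters both reverse every entry, so
  only one entry can be normalised.\<close>

lemma classify_three_active:
  "list_all (\<lambda>f. list_all (\<lambda>g. list_all (\<lambda>e. classify (e, f, g)) (half_entries True))
    (entries True)) (entries True)"
  by code_simp


section \<open>Soundness of the decision procedure and of the certificates\<close>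

definition aut :: "code \<Rightarrow> (state, bool) automaton" where
  "aut C = \<lparr>transition = (\<lambda>q x. case entry C q of (s, r0, r1) \<Rightarrow> if x then r1 else r0),
    out = (\<lambda>q. if fst (entry C q) then Not else id)\<rparr>"

lemma inv_Not [simp]: "inv_into UNIV Not = Not"
  by (rule inv_equality) auto

lemma invertible_aut [simp]: "invertible_automaton (aut C)"
  by (simp add: invertible_automaton_def aut_def involuntory_imp_bij)

lemma letter_act_aut_Cons:
  "letter_section (entry C q) e y = (l, z) \<Longrightarrow>
    letter_act (aut C) (q, e) (y # v) = z # letter_act (aut C) l v"
  by (cases "(entry C q, e, y)" rule: letter_section.cases)
    (auto simp: letter_act_def aut_def inverse_automaton_def)

lemma word_act_aut_Cons:
  "word_act (aut C) w (x # v) =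
    snd (word_section C w x) # word_act (aut C) (fst (word_section C w x)) v"
proof (induction w)
  case (Cons l w)
  obtain w' y where w: "word_section C w x = (w', y)"
    by fastforce
  obtain q e where l: "l = (q, e)"
    by fastforce
  obtain l' z where s: "letter_section (entry C q) e y = (l', z)"
    by fastforce
  show ?case
    using Cons by (simp add: w l s letter_act_aut_Cons word_act_reduced_cons)
qed simp

lemma snd_letter_section: "snd (letter_section p e (\<not> y)) \<longleftrightarrow> \<not> snd (letter_section p e y)"
  by (cases "(p, e, y)" rule: letter_section.cases) auto

text \<open>A word permutes the two letters, so testing \<open>False\<close> alone decides whether
  it fixes both.\<close>

lemma snd_word_section: "snd (word_section C w (\<not> x)) \<longleftrightarrow> \<not> snd (word_section C w x)"
proof (induction w)
  case (Cons l w)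
  obtain w1 y1 w2 y2 where w: "word_section C w x = (w1, y1)" "word_section C w (\<not> x) = (w2, y2)"
    by fastforce
  then have "y2 = (\<not> y1)"
    using Cons by simp
  then show ?case
    using snd_letter_section[of "entry C (fst l)" "snd l" y1]
    by (cases l) (auto simp: w split: prod.splits)
qed simp

text \<open>A word that moves \<open>False\<close> is nontrivial, and a nontrivial section makes the
  word itself nontrivial.\<close>

lemma decide_nontrivial:
  "decide n C seen todo = Some False \<Longrightarrow> \<exists>w \<in> set todo. word_act (aut C) w \<noteq> id"
proof (induction n arbitrary: seen todo)
  case (Suc n)
  then obtain w todo' where todo: "todo = w # todo'"
    by (cases todo) auto
  obtain u y where u: "word_section C w False = (u, y)"
    by fastforce
  let ?u = "fst (word_section C w True)"
  consider "w = [] \<or> w \<in> set seen" | "w \<noteq> []" "w \<notin> set seen" "y" | "w \<noteq> []" "w \<notin> set seen" "\<not> y"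
    by blast
  then show ?case
  proof cases
    case 1
    then have "decide n C seen todo' = Some False"
      using Suc.prems todo by (auto split: if_splits)
    then show ?thesis
      using Suc.IH todo by auto
  next
    case 2
    then have "word_act (aut C) w [False] \<noteq> id [False]"
      using word_act_aut_Cons[of C w False "[]"] u by simp
    then have "word_act (aut C) w \<noteq> id"
      by metis
    then show ?thesis
      using todo by (metis list.set_intros(1))
  next
    case 3
    then have "decide n C (w # seen) (u # ?u # todo') = Some False"
      using Suc.prems todo u by simp
    then obtain v where v: "v \<in> set (u # ?u # todo')" "word_act (aut C) v \<noteq> id"
      using Suc.IH by blast
    show ?thesis
    proof (cases "v \<in> set todo'")
      case False
      then obtain x where x: "v = fst (word_section C w x)"
        using v(1) u by (metis fst_conv set_ConsD)
      have "word_act (aut C) w \<noteq> id"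
      proof
        assume "word_act (aut C) w = id"
        then have "word_act (aut C) v z = z" for z
          using word_act_aut_Cons[of C w x z] x by simp
        then show False
          using v(2) by (auto simp: fun_eq_iff)
      qed
      then show ?thesis
        using todo by (metis list.set_intros(1))
    qed (use v todo in auto)
  qed
qed simp

text \<open>A bisimulation with the identity. The empty word is adjoined to the admissible sections
  because the search discards it unrecorded.\<close>

definition section_closed :: "code \<Rightarrow> (state \<times> bool) list set \<Rightarrow> bool" where
  "section_closed C T \<longleftrightarrow>
    (\<forall>w \<in> T. \<not> snd (word_section C w False) \<and> (\<forall>x. fst (word_section C w x) \<in> insert [] T))"

lemma section_closed_trivial:
  assumes "section_closed C T" "w \<in> insert [] T"
  shows "word_act (aut C) w = id"
proof -
  have "word_act (aut C) w v = v" if "w \<in> insert [] T" for v w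
    using that
  proof (induction v arbitrary: w)
    case Nil
    have "word_act (aut C) w [] = []"
      by (induction w) (auto simp: letter_act_def)
    then show ?case .
  next
    case (Cons x v)
    have "snd (word_section C w x) = x"
      using Cons.prems assms(1) snd_word_section[of C w False]
      by (cases x) (auto simp: section_closed_def)
    moreover have "fst (word_section C w x) \<in> insert [] T"
      using Cons.prems assms(1) by (auto simp: section_closed_def)
    ultimately show ?case
      using Cons.IH by (simp add: word_act_aut_Cons)
  qed
  then show ?thesis
    using assms(2) by auto
qed

text \<open>The invariant is that the nonempty sections of recorded words are recorded or pending;
  once nothing is pending, the recorded words are closed under sections.\<close>

lemma decide_trivial:
  assumes "decide n C seen todo = Some True"
    and "\<And>w. w \<in> set seen \<Longrightarrow> \<not> snd (word_section C w False) \<and>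
      (\<forall>x. fst (word_section C w x) \<in> insert [] (set seen \<union> set todo))"
  shows "\<exists>T. section_closed C T \<and> set seen \<union> set todo \<subseteq> insert [] T"
  using assms
proof (induction n arbitrary: seen todo)
  case (Suc n)
  show ?case
  proof (cases todo)
    case Nil
    then show ?thesis
      using Suc.prems by (intro exI[of _ "set seen"]) (auto simp: section_closed_def)
  next
    case todo: (Cons w todo')
    obtain u y where u: "word_section C w False = (u, y)"
      by fastforce
    let ?todo = "u # fst (word_section C w True) # todo'"
    consider "w = [] \<or> w \<in> set seen" | "w \<noteq> []" "w \<notin> set seen"
      by blast
    then show ?thesis
    proof cases
      case 1
      then have dec: "decide n C seen todo' = Some True"
        using Suc.prems(1) todo by (auto split: if_splits)
      have "insert [] (set seen \<union> set todo) = insert [] (set seen \<union> set todo')"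
        using 1 todo by auto
      then show ?thesis
        using Suc.IH[OF dec] Suc.prems(2) 1 todo by auto
    next
      case 2
      then have y: "\<not> y" and dec: "decide n C (w # seen) ?todo = Some True"
        using Suc.prems(1) todo u by (auto split: if_splits)
      have "\<not> snd (word_section C v False) \<and>
          (\<forall>x. fst (word_section C v x) \<in> insert [] (set (w # seen) \<union> set ?todo))"
        if "v \<in> set (w # seen)" for v
      proof (cases "v = w")
        case True
        have "fst (word_section C w x) \<in> {u, fst (word_section C w True)}" for x
          by (cases x) (simp_all add: u)
        then show ?thesis
          using True y u by auto
      next
        case False
        then show ?thesis
          using that Suc.prems(2)[of v] todo by auto
      qed
      then have "\<exists>T. section_closed C T \<and> set (w # seen) \<union> set ?todo \<subseteq> insert [] T"
        by (rule Suc.IH[OF dec])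
      then show ?thesis
        using todo by auto
    qed
  qed
qed simp

lemma is_trivialD:
  assumes "is_trivial n C w"
  shows "word_act (aut C) w = id"
proof -
  obtain T where "section_closed C T" "w \<in> insert [] T"
    using decide_trivial[of n C "[]" "[w]"] assms by (auto simp: is_trivial_def)
  then show ?thesis
    by (rule section_closed_trivial)
qed

lemma is_nontrivialD: "is_nontrivial C w \<Longrightarrow> word_act (aut C) w \<noteq> id"
  using decide_nontrivial[of 40 C "[]" "[w]"] by (auto simp: is_nontrivial_def)

lemma commutator_word_eq_id:
  assumes A: "invertible_automaton A"
  shows "word_act A (commutator_word u v) = id \<longleftrightarrow>
    word_act A u \<circ> word_act A v = word_act A v \<circ> word_act A u"
proof
  note inv = word_act_inverse_word[OF A]
  assume id: "word_act A (commutator_word u v) = id"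
  have "word_act A u (word_act A v w) = word_act A v (word_act A u w)" for w
    using fun_cong[OF id, of "word_act A v (word_act A u w)"]
    by (simp add: commutator_word_def word_act_append inv)
  then show "word_act A u \<circ> word_act A v = word_act A v \<circ> word_act A u"
    by (simp add: fun_eq_iff)
next
  note inv = word_act_inverse_word[OF A]
  assume "word_act A u \<circ> word_act A v = word_act A v \<circ> word_act A u"
  then have "word_act A u (word_act A v w) = word_act A v (word_act A u w)" for w
    by (metis comp_apply)
  then show "word_act A (commutator_word u v) = id"
    by (simp add: fun_eq_iff commutator_word_def word_act_append inv)
qed

text \<open>In a CSA group maximal abelian subgroups are malnormal; the second condition is a consequence of
  this that suffices here.\<close>

definition torsion_free_CSA :: "('a, 'm) monoid_scheme \<Rightarrow> bool" where
  "torsion_free_CSA G \<longleftrightarrow>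
    (\<forall>x \<in> carrier G. x \<otimes>\<^bsub>G\<^esub> x = \<one>\<^bsub>G\<^esub> \<longrightarrow> x = \<one>\<^bsub>G\<^esub>) \<and>
    (\<forall>x \<in> carrier G. \<forall>g \<in> carrier G.
      x \<otimes>\<^bsub>G\<^esub> (g \<otimes>\<^bsub>G\<^esub> x \<otimes>\<^bsub>G\<^esub> inv\<^bsub>G\<^esub> g) = (g \<otimes>\<^bsub>G\<^esub> x \<otimes>\<^bsub>G\<^esub> inv\<^bsub>G\<^esub> g) \<otimes>\<^bsub>G\<^esub> x \<longrightarrow>
      x \<otimes>\<^bsub>G\<^esub> g = g \<otimes>\<^bsub>G\<^esub> x)"

lemma torsion_free_CSA_free_group: "torsion_free_CSA (free_group S)"
  unfolding torsion_free_CSA_def using square_eq_one commute_conjugate by blast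

lemma torsion_free_CSA_iso:
  assumes G: "group G" and H: "group H" and iso: "G \<cong> H" and CSA: "torsion_free_CSA H"
  shows "torsion_free_CSA G"
proof -
  obtain h where h: "h \<in> iso G H"
    using iso by (auto simp: is_iso_def)
  interpret G: group G by (rule G)
  interpret H: group H by (rule H)
  interpret group_hom G H h
    using h by unfold_locales (auto simp: iso_def)
  have inj: "x = y" if "x \<in> carrier G" "y \<in> carrier G" "h x = h y" for x y
    using h that by (auto simp: iso_def bij_betw_def inj_on_def)
  show ?thesis
    unfolding torsion_free_CSA_def
  proof (intro conjI ballI impI)
    fix x assume x: "x \<in> carrier G" "x \<otimes>\<^bsub>G\<^esub> x = \<one>\<^bsub>G\<^esub>"
    then have "h x \<otimes>\<^bsub>H\<^esub> h x = \<one>\<^bsub>H\<^esub>"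
      by (metis hom_mult hom_one)
    then have "h x = \<one>\<^bsub>H\<^esub>"
      using CSA x(1) hom_closed unfolding torsion_free_CSA_def by blast
    then have "h x = h \<one>\<^bsub>G\<^esub>"
      by simp
    then show "x = \<one>\<^bsub>G\<^esub>"
      using inj x(1) by blast
  next
    fix x g assume x: "x \<in> carrier G" and g: "g \<in> carrier G"
    define y where "y = g \<otimes>\<^bsub>G\<^esub> x \<otimes>\<^bsub>G\<^esub> inv\<^bsub>G\<^esub> g"
    assume "x \<otimes>\<^bsub>G\<^esub> (g \<otimes>\<^bsub>G\<^esub> x \<otimes>\<^bsub>G\<^esub> inv\<^bsub>G\<^esub> g) = (g \<otimes>\<^bsub>G\<^esub> x \<otimes>\<^bsub>G\<^esub> inv\<^bsub>G\<^esub> g) \<otimes>\<^bsub>G\<^esub> x"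
    then have eq: "h (x \<otimes>\<^bsub>G\<^esub> y) = h (y \<otimes>\<^bsub>G\<^esub> x)"
      by (simp add: y_def)
    have y: "y \<in> carrier G" "h y = h g \<otimes>\<^bsub>H\<^esub> h x \<otimes>\<^bsub>H\<^esub> inv\<^bsub>H\<^esub> h g"
      using x g by (simp_all add: y_def)
    have "h x \<otimes>\<^bsub>H\<^esub> h y = h y \<otimes>\<^bsub>H\<^esub> h x"
      using eq hom_mult[OF x y(1)] hom_mult[OF y(1) x] by metis
    then have "h x \<otimes>\<^bsub>H\<^esub> h g = h g \<otimes>\<^bsub>H\<^esub> h x"
      using CSA hom_closed[OF x] hom_closed[OF g] unfolding y(2) torsion_free_CSA_def by blast
    then have "h (x \<otimes>\<^bsub>G\<^esub> g) = h (g \<otimes>\<^bsub>G\<^esub> x)"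
      using hom_mult[OF x g] hom_mult[OF g x] by metis
    then show "x \<otimes>\<^bsub>G\<^esub> g = g \<otimes>\<^bsub>G\<^esub> x"
      using inj x g by blast
  qed
qed

lemma find_involution_sound:
  assumes "find_involution C us"
  shows "\<not> torsion_free_CSA (automaton_group (aut C))"
  using assms
proof (induction us)
  case (Cons u us)
  show ?case
  proof (cases "is_nontrivial C u \<and> is_trivial 20 C (u @ u)")
    case True
    then have "word_act (aut C) u \<noteq> id" "word_act (aut C) u \<circ> word_act (aut C) u = id"
      using is_nontrivialD is_trivialD[of 20 C "u @ u"] by (blast, simp add: word_act_append)
    moreover have "word_act (aut C) u \<in> carrier (automaton_group (aut C))"
      by (simp add: carrier_automaton_group)
    ultimately show ?thesis
      unfolding torsion_free_CSA_def automaton_group_simps by blast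
  qed (use Cons in \<open>auto split: if_splits\<close>)
qed simp

lemma find_commuting_conjugate_sound:
  assumes "find_commuting_conjugate n C us"
  shows "\<not> torsion_free_CSA (automaton_group (aut C))"
  using assms
proof (induction us)
  case (Cons p us)
  obtain u l where p: "p = (u, l)"
    by (cases p)
  let ?A = "aut C"
  let ?G = "automaton_group ?A"
  let ?v = "l # u @ [inv_letter l]"
  show ?case
  proof (cases "is_trivial n C (commutator_word u ?v) \<and> is_nontrivial C (commutator_word u [l])")
    case True
    then have 1: "word_act ?A u \<circ> word_act ?A ?v = word_act ?A ?v \<circ> word_act ?A u"
      and 2: "word_act ?A u \<circ> word_act ?A [l] \<noteq> word_act ?A [l] \<circ> word_act ?A u"
      using is_nontrivialD is_trivialD commutator_word_eq_id[OF invertible_aut] by blast+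
    have "word_act ?A ?v = word_act ?A [l] \<otimes>\<^bsub>?G\<^esub> word_act ?A u \<otimes>\<^bsub>?G\<^esub> inv\<^bsub>?G\<^esub> word_act ?A [l]"
      by (simp add: inv_word_act del: word_act.simps(2)) (simp add: inverse_word_def word_act_append comp_assoc)
    then show ?thesis
      using 1 2 unfolding torsion_free_CSA_def
      by (metis automaton_group_simps(1) carrier_automaton_group invertible_aut rangeI)
  qed (use Cons p in \<open>auto split: if_splits\<close>)
qed simp

lemma commuting_generators:
  assumes A: "invertible_automaton A"
    and comm: "\<And>p q. act A p \<circ> act A q = act A q \<circ> act A p"
  shows "comm_group (automaton_group A)"
proof -
  have inverse: "g \<circ> act (inverse_automaton A) q = act (inverse_automaton A) q \<circ> g"
    if "g \<circ> act A q = act A q \<circ> g" for g q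
  proof
    fix v
    have "act A q (g (act (inverse_automaton A) q v)) = g v"
      using fun_cong[OF that, of "act (inverse_automaton A) q v"]
      by (simp add: act_inverse_automaton[OF A])
    from arg_cong[OF this, of "act (inverse_automaton A) q"]
    show "(g \<circ> act (inverse_automaton A) q) v = (act (inverse_automaton A) q \<circ> g) v"
      by (simp add: act_inverse_automaton[OF A])
  qed
  have act_letter: "letter_act A l \<circ> act A p = act A p \<circ> letter_act A l" for p l
    using comm inverse[OF comm] by (cases "snd l") (simp_all add: letter_act_def)
  have letters: "letter_act A l \<circ> letter_act A k = letter_act A k \<circ> letter_act A l" for k l
    using act_letter inverse[OF act_letter] by (cases "snd k") (simp_all add: letter_act_def[of A k])
  have letter_word: "letter_act A l \<circ> word_act A w = word_act A w \<circ> letter_act A l" for l w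
  proof (induction w)
    case (Cons k w)
    have "letter_act A l \<circ> word_act A (k # w) = letter_act A k \<circ> (letter_act A l \<circ> word_act A w)"
      by (simp only: word_act.simps comp_assoc[symmetric] letters[of l k])
    then show ?case
      by (simp only: word_act.simps comp_assoc Cons)
  qed simp
  have "word_act A u \<circ> word_act A w = word_act A w \<circ> word_act A u" for u w
  proof (induction u)
    case (Cons k u)
    have "word_act A (k # u) \<circ> word_act A w = (letter_act A k \<circ> word_act A w) \<circ> word_act A u"
      by (simp only: word_act.simps comp_assoc Cons)
    then show ?case
      by (simp only: word_act.simps comp_assoc letter_word)
  qed simp
  then show ?thesis
    by (intro group.group_comm_groupI group_automaton_group)
      (auto simp: carrier_automaton_group[OF A])
qed

lemma commuting_states_sound:
  assumes "commuting_states C"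
  shows "comm_group (automaton_group (aut C))"
proof (rule commuting_generators)
  have comm: "act (aut C) p \<circ> act (aut C) q = act (aut C) q \<circ> act (aut C) p"
    if "is_trivial 40 C (commutator_word [(p, True)] [(q, True)])" for p q
    using is_trivialD[OF that] commutator_word_eq_id[OF invertible_aut]
    by (auto simp: letter_act_def)
  have "act (aut C) Sa \<circ> act (aut C) Sb = act (aut C) Sb \<circ> act (aut C) Sa"
    "act (aut C) Sa \<circ> act (aut C) Sc = act (aut C) Sc \<circ> act (aut C) Sa"
    "act (aut C) Sb \<circ> act (aut C) Sc = act (aut C) Sc \<circ> act (aut C) Sb"
    using assms by (auto intro!: comm simp: commuting_states_def split: if_splits)
  then show "act (aut C) p \<circ> act (aut C) q = act (aut C) q \<circ> act (aut C) p" for p q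
    by (cases p; cases q) auto
qed simp

section \<open>Symmetries expressed on codes\<close>

definition flip :: "entry \<Rightarrow> entry" where
  "flip = (\<lambda>(s, r0, r1). (s, r1, r0))"

definition rename :: "(state \<Rightarrow> state) \<Rightarrow> entry \<Rightarrow> entry" where
  "rename f = (\<lambda>(s, r0, r1). (s, f r0, f r1))"

fun flip_code :: "code \<Rightarrow> code" where
  "flip_code (ea, eb, ec) = (flip ea, flip eb, flip ec)"

fun inverse_code :: "code \<Rightarrow> code" where
  "inverse_code (ea, eb, ec) =
    (if fst ea then flip ea else ea, if fst eb then flip eb else eb, if fst ec then flip ec else ec)"

fun swap_ab :: "code \<Rightarrow> code" where
  "swap_ab (ea, eb, ec) = (rename (exchange Sc) eb, rename (exchange Sc) ea, rename (exchange Sc) ec)"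

fun swap_bc :: "code \<Rightarrow> code" where
  "swap_bc (ea, eb, ec) = (rename (exchange Sa) ea, rename (exchange Sa) ec, rename (exchange Sa) eb)"

lemma inv_exchange: "inv_into UNIV (exchange r) = exchange r"
  by (rule inv_equality) auto

lemma symmetry_step_flip: "symmetry_step (aut C) (aut (flip_code C))"
proof -
  obtain ea eb ec where C: "C = (ea, eb, ec)"
    by (cases C)
  have "transition (rename_letters Not (aut C)) q x = transition (aut (flip_code C)) q x"
    "out (rename_letters Not (aut C)) q x = out (aut (flip_code C)) q x" for q x
    by (cases q; simp add: C rename_letters_def aut_def flip_def split: prod.split)+
  then have "rename_letters Not (aut C) = aut (flip_code C)"
    by (intro automaton.equality) (auto simp: fun_eq_iff)
  then show ?thesis
    using symmetry_step.letters[of Not "aut C"] by (simp add: involuntory_imp_bij)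
qed

lemma symmetry_step_inverse: "symmetry_step (aut C) (aut (inverse_code C))"
proof -
  obtain ea eb ec where C: "C = (ea, eb, ec)"
    by (cases C)
  have "transition (inverse_automaton (aut C)) q x = transition (aut (inverse_code C)) q x"
    "out (inverse_automaton (aut C)) q x = out (aut (inverse_code C)) q x" for q x
    by (cases q; simp add: C inverse_automaton_def aut_def flip_def split: prod.split)+
  then have "inverse_automaton (aut C) = aut (inverse_code C)"
    by (intro automaton.equality) (auto simp: fun_eq_iff)
  then show ?thesis
    using symmetry_step.inverse[of "aut C"] by simp
qed

lemma symmetry_step_swap:
  "symmetry_step (aut C) (aut (swap_ab C))" "symmetry_step (aut C) (aut (swap_bc C))"
proof -
  obtain ea eb ec where C: "C = (ea, eb, ec)"
    by (cases C)
  have "transition (rename_states (exchange Sc) (aut C)) q x = transition (aut (swap_ab C)) q x"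
    "out (rename_states (exchange Sc) (aut C)) q x = out (aut (swap_ab C)) q x" for q x
    by (cases q; simp add: C rename_states_def aut_def rename_def inv_exchange split: prod.split)+
  then have "rename_states (exchange Sc) (aut C) = aut (swap_ab C)"
    by (intro automaton.equality) (auto simp: fun_eq_iff)
  then show "symmetry_step (aut C) (aut (swap_ab C))"
    using symmetry_step.states[OF bij_exchange[of Sc], of "aut C"] by simp
  have "transition (rename_states (exchange Sa) (aut C)) q x = transition (aut (swap_bc C)) q x"
    "out (rename_states (exchange Sa) (aut C)) q x = out (aut (swap_bc C)) q x" for q x
    by (cases q; simp add: C rename_states_def aut_def rename_def inv_exchange split: prod.split)+
  then have "rename_states (exchange Sa) (aut C) = aut (swap_bc C)"
    by (intro automaton.equality) (auto simp: fun_eq_iff)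
  then show "symmetry_step (aut C) (aut (swap_bc C))"
    using symmetry_step.states[OF bij_exchange[of Sa], of "aut C"] by simp
qed

text \<open>A nonabelian free group rules out the first two alternatives and thereby forces
  symmetry.\<close>

definition classified :: "(state, bool) automaton \<Rightarrow> bool" where
  "classified A \<longleftrightarrow> comm_group (automaton_group A) \<or> \<not> torsion_free_CSA (automaton_group A) \<or>
    symmetry_step\<^sup>*\<^sup>* A aleshin_vorobets"

text \<open>The first two alternatives are invariant under isomorphism and the third absorbs one
  more step, so any symmetric image may be classified instead.\<close>

lemma classified_step:
  assumes AB: "symmetry_step A B" and A: "invertible_automaton A" and B: "classified B"
  shows "classified A"
proof -
  have iso: "automaton_group A \<cong> automaton_group B"
    using symmetry_step_iso[OF AB A] by blast
  have iso': "automaton_group B \<cong> automaton_group A"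
    using group.iso_sym[OF group_automaton_group iso] .
  from B consider "comm_group (automaton_group B)" | "\<not> torsion_free_CSA (automaton_group B)"
    | "symmetry_step\<^sup>*\<^sup>* B aleshin_vorobets"
    by (auto simp: classified_def)
  then show ?thesis
  proof cases
    case 1
    then show ?thesis
      using comm_group.iso_imp_comm_group[OF 1 iso' group.is_monoid[OF group_automaton_group]] by (simp add: classified_def)
  next
    case 2
    then show ?thesis
      using torsion_free_CSA_iso[OF group_automaton_group group_automaton_group iso']
      by (auto simp: classified_def)
  next
    case 3
    then show ?thesis
      using AB by (auto simp: classified_def intro: converse_rtranclp_into_rtranclp)
  qed
qed

lemma aleshin_vorobets_aut:
  "aleshin_vorobets = aut ((True, Sb, Sc), (True, Sc, Sb), (False, Sa, Sa))"
proof -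
  let ?A = "aut ((True, Sb, Sc), (True, Sc, Sb), (False, Sa, Sa))"
  have "transition aleshin_vorobets q x = transition ?A q x" "out aleshin_vorobets q x = out ?A q x" for q x
    by (cases q; simp add: aleshin_vorobets_def aut_def)+
  then show ?thesis
    by (intro automaton.equality) (auto simp: fun_eq_iff)
qed

lemma classify_sound:
  assumes "classify C"
  shows "classified (aut C)"
proof -
  have "C = ((True, Sb, Sc), (True, Sc, Sb), (False, Sa, Sa)) \<or>
      C = ((True, Sa, Sc), (True, Sc, Sa), (False, Sb, Sb)) \<or>
      comm_group (automaton_group (aut C)) \<or> \<not> torsion_free_CSA (automaton_group (aut C))"
    using assms commuting_states_sound find_involution_sound find_commuting_conjugate_sound
    unfolding classify_def by (auto split: if_splits)
  moreover have "symmetry_step\<^sup>*\<^sup>* (aut D) aleshin_vorobets"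
    if "D = ((True, Sa, Sc), (True, Sc, Sa), (False, Sb, Sb))" for D
  proof -
    have "aut (flip_code (swap_ab D)) = aleshin_vorobets"
      by (simp add: that rename_def flip_def aleshin_vorobets_aut)
    then have "symmetry_step (aut (swap_ab D)) aleshin_vorobets"
      using symmetry_step_flip[of "swap_ab D"] by simp
    then show ?thesis
      using symmetry_step_swap(1)[of D] by (meson r_into_rtranclp converse_rtranclp_into_rtranclp)
  qed
  ultimately show ?thesis
    by (auto simp: classified_def aleshin_vorobets_aut)
qed

lemma classified_by:
  "classified (aut (flip_code C)) \<Longrightarrow> classified (aut C)"
  "classified (aut (inverse_code C)) \<Longrightarrow> classified (aut C)"
  "classified (aut (swap_ab C)) \<Longrightarrow> classified (aut C)"
  "classified (aut (swap_bc C)) \<Longrightarrow> classified (aut C)"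
  by (rule classified_step[OF symmetry_step_flip] classified_step[OF symmetry_step_inverse]
      classified_step[OF symmetry_step_swap(1)] classified_step[OF symmetry_step_swap(2)]; simp)+

section \<open>Reduction of arbitrary codes to the normalised ones\<close>

lemma flip_simps [simp]: "flip (flip e) = e" "fst (flip e) = fst e" "flip (s, r0, r1) = (s, r1, r0)"
  by (simp_all add: flip_def split: prod.split)

lemma in_entries: "(s, r0, r1) \<in> set (entries s)"
  by (cases r0; cases r1) (simp_all add: entries_def)

lemma fst_half_entries: "e \<in> set (half_entries s) \<Longrightarrow> fst e = s"
  by (auto simp: half_entries_def)

lemma half_entries_or_flip: "(s, r0, r1) \<in> set (half_entries s) \<or> (s, r1, r0) \<in> set (half_entries s)"
  by (cases r0; cases r1) (simp_all add: half_entries_def)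

text \<open>Renaming the letters reverses all entries and so normalises the first one;
  \<open>P\<close> describes the other two and must survive the reversal.\<close>

lemma classified_active_inactive:
  assumes "\<And>e f g. e \<in> set (half_entries True) \<Longrightarrow> P f g \<Longrightarrow> classified (aut (e, f, g))"
    and "\<And>f g. P f g \<Longrightarrow> P (flip f) (flip g)"
    and "P f g"
  shows "classified (aut ((True, r0, r1), f, g))"
proof (cases "(True, r0, r1) \<in> set (half_entries True)")
  case False
  then have "(True, r1, r0) \<in> set (half_entries True)"
    using half_entries_or_flip by blast
  then have "classified (aut ((True, r1, r0), flip f, flip g))"
    using assms by blast
  then show ?thesis
    using classified_by(1)[of "((True, r0, r1), f, g)"] by (simp add: flip_def)
qed (use assms in blast)

lemma classified_one_active:
  "classified (aut ((True, r0, r1), (False, r2, r3), (False, r4, r5)))"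
proof (rule classified_active_inactive[where P = "\<lambda>f g. \<not> fst f \<and> \<not> fst g"])
  fix e f g :: entry assume e: "e \<in> set (half_entries True)" and fg: "\<not> fst f \<and> \<not> fst g"
  obtain r2 r3 r4 r5 where f: "f = (False, r2, r3)" and g: "g = (False, r4, r5)"
    using fg by (cases f; cases g) auto
  have base: "classified (aut (e, f', g'))" if "f' \<in> set (half_entries False)" "g' \<in> set (entries False)" for f' g'
    using classify_one_active e that by (auto simp: list_all_iff intro: classify_sound)
  show "classified (aut (e, f, g))"
  proof (cases "f \<in> set (half_entries False)")
    case True
    then show ?thesis
      using base in_entries f g by blast
  next
    case False
    \<comment> \<open>Renaming the letters and then inverting restores the active entry, so the net
      effect is to reverse the inactive ones.\<close>
    then have "classified (aut (e, flip f, flip g))"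
      using base in_entries half_entries_or_flip[of False r2 r3] f g by (auto simp: flip_def)
    moreover have "fst e"
      using fst_half_entries e by blast
    ultimately show ?thesis
      by - (rule classified_by(1), rule classified_by(2), simp add: f g)
  qed
qed (auto simp: flip_def)

lemma classified_two_active:
  "classified (aut ((True, r0, r1), (True, r2, r3), (False, r4, r5)))"
proof (rule classified_active_inactive[where P = "\<lambda>f g. fst f \<and> \<not> fst g"])
  fix e f g :: entry assume e: "e \<in> set (half_entries True)" and fg: "fst f \<and> \<not> fst g"
  obtain r2 r3 r4 r5 where f: "f = (True, r2, r3)" and g: "g = (False, r4, r5)"
    using fg by (cases f; cases g) auto
  have base: "classified (aut (e, f', g'))" if "f' \<in> set (entries True)" "g' \<in> set (half_entries False)" for f' g'
    using classify_two_active e that by (auto simp: list_all_iff intro: classify_sound)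
  show "classified (aut (e, f, g))"
  proof (cases "g \<in> set (half_entries False)")
    case True
    then show ?thesis
      using base in_entries f g by blast
  next
    case False
    \<comment> \<open>The same combination leaves both active entries in place and reverses only
      \<open>g\<close>.\<close>
    then have "classified (aut (e, f, flip g))"
      using base in_entries half_entries_or_flip[of False r4 r5] f g by (auto simp: flip_def)
    moreover have "fst e"
      using fst_half_entries e by blast
    ultimately show ?thesis
      by - (rule classified_by(1), rule classified_by(2), simp add: f g)
  qed
qed (auto simp: flip_def)

lemma classified_three_active:
  "classified (aut ((True, r0, r1), (True, r2, r3), (True, r4, r5)))"
proof (rule classified_active_inactive[where P = "\<lambda>f g. fst f \<and> fst g"])
  fix e f g :: entry assume e: "e \<in> set (half_entries True)" and fg: "fst f \<and> fst g"
  then have "f \<in> set (entries True)" "g \<in> set (entries True)"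
    using in_entries by (cases f; cases g; auto)+
  then show "classified (aut (e, f, g))"
    using classify_three_active e by (auto simp: list_all_iff intro: classify_sound)
qed (auto simp: flip_def)

lemma classified_inactive:
  "classified (aut ((False, r0, r1), (False, r2, r3), (False, r4, r5)))" (is "classified ?A")
proof -
  have "act ?A q v = v" for q v
  proof (induction v arbitrary: q)
    case (Cons x v)
    then show ?case
      by (cases q) (simp_all add: aut_def)
  qed simp
  then have "comm_group (automaton_group ?A)"
    by (intro commuting_generators) (auto simp: fun_eq_iff)
  then show ?thesis
    by (simp add: classified_def)
qed

text \<open>Exchanging neighbouring states brings the active ones to the front, leaving one case for
  each number of active states.\<close>

lemma classified_aut: "classified (aut C)"
proof -
  obtain s0 r0 r1 s1 r2 r3 s2 r4 r5 where C: "C = ((s0, r0, r1), (s1, r2, r3), (s2, r4, r5))"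
    by (cases C) auto
  note base = classified_one_active classified_two_active classified_three_active classified_inactive
  have ab: "classified (aut ((True, e), (s, f), (False, g)))" for s and e f g :: "state \<times> state"
    using base by (cases s; cases e; cases f; cases g) auto
  have abc: "classified (aut ((True, e), (s, f), (t, g)))" for s t and e f g :: "state \<times> state"
  proof (cases "t \<and> \<not> s")
    case True
    then show ?thesis
      using ab by - (rule classified_by(4), simp add: rename_def split: prod.split)
  next
    case False
    then show ?thesis
      using ab base by (cases s; cases t; cases e; cases f; cases g) auto
  qed
  have sec: "classified (aut ((s, e), (True, f), (t, g)))" for s t and e f g :: "state \<times> state"
    using abc by - (rule classified_by(3), simp add: rename_def split: prod.split)
  show ?thesis
  proof (cases "s0 \<or> s1")
    case True
    then show ?thesis
      using abc sec C by auto
  next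
    case False
    show ?thesis
    proof (cases s2)
      case True
      then show ?thesis
        using False sec C by - (rule classified_by(4), simp add: rename_def)
    next
      case False
      then show ?thesis
        using \<open>\<not> (s0 \<or> s1)\<close> base C by simp
    qed
  qed
qed

section \<open>Freeness of the Aleshin-Vorobets group\<close>

lemma act_bellaterra_None: "act bellaterra None v = map Not v"
  by (induction v) (simp_all add: bellaterra_def toggles_def)

lemma out_bellaterra: "out bellaterra q x = (x \<noteq> toggles Sc q)"
  by (simp add: bellaterra_def)

lemma act_bellaterra_involution [simp]: "act bellaterra q (act bellaterra q v) = v"
proof (induction v arbitrary: q)
  case (Cons x v)
  have "transition bellaterra q (x \<noteq> toggles Sc q) = transition bellaterra q x"
    by (auto simp: bellaterra_def toggles_def split: option.split state.split)
  moreover have "((x \<noteq> toggles Sc q) \<noteq> toggles Sc q) = x"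
    by auto
  ultimately show ?case
    using Cons by (simp only: act.simps out_bellaterra)
qed simp

lemma act_aleshin_vorobets:
  "act aleshin_vorobets q v = act bellaterra None (act bellaterra (Some q) v)"
  unfolding act_bellaterra_None
proof (induction v arbitrary: q)
  case (Cons x v)
  have "out aleshin_vorobets q x \<longleftrightarrow> \<not> (x \<noteq> toggles Sc (Some q))"
    by (cases q) (auto simp: aleshin_vorobets_def toggles_def)
  moreover have "transition bellaterra (Some q) x = Some (transition aleshin_vorobets q x)"
    by (cases q) (auto simp: aleshin_vorobets_def bellaterra_def)
  ultimately show ?case
    using Cons by (simp add: out_bellaterra)
qed simp

lemma act_inverse_aleshin_vorobets:
  "act (inverse_automaton aleshin_vorobets) q v = act bellaterra (Some q) (act bellaterra None v)"
proof -
  have "act aleshin_vorobets q (act bellaterra (Some q) (act bellaterra None v)) = v"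
    by (simp add: act_aleshin_vorobets)
  then show ?thesis
    by (metis act_inverse_automaton(1)[OF invertible_aleshin_vorobets])
qed

text \<open>A state is written as \<epsilon> times its primed state and an inverse in the opposite
  order; the case distinction cancels a pair of adjacent \<epsilon> at once.\<close>

fun expand :: "(state \<times> bool) list \<Rightarrow> state option list" where
  "expand [] = []"
| "expand ((q, True) # w) = None # Some q # expand w"
| "expand ((q, False) # w) =
    Some q # (case expand w of None # u \<Rightarrow> u | u \<Rightarrow> None # u)"

lemma foldr_expand: "foldr (act bellaterra) (expand w) v = word_act aleshin_vorobets w v"
proof (induction w rule: expand.induct)
  case (2 q w)
  then show ?case
    by (simp add: letter_act_def act_aleshin_vorobets)
next
  case (3 q w)
  have "foldr (act bellaterra) (case u of None # u' \<Rightarrow> u' | u' \<Rightarrow> None # u') v =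
      act bellaterra None (foldr (act bellaterra) u v)" for u
    by (auto split: list.split option.split)
  then show ?case
    using 3 by (simp add: letter_act_def act_inverse_aleshin_vorobets)
qed simp

text \<open>Equal neighbours could come only from a state next to its own inverse, which reducedness
  forbids. The beginning of the expansion is recorded for the induction.\<close>

lemma expand_reduced:
  assumes "reduced_word w"
  shows "distinct_adj (expand w) \<and>
    (case w of [] \<Rightarrow> True
     | (q, True) # w' \<Rightarrow> \<exists>u. expand w = None # Some q # u
     | (q, False) # w' \<Rightarrow> \<exists>u. expand w = Some q # u)"
  using assms
proof (induction w)
  case (Cons l w)
  obtain q b where l: "l = (q, b)"
    by fastforce
  have w: "reduced_word w"
    using Cons.prems by (cases w) (auto simp: reduced_word_def)
  show ?case
  proof (cases w)
    case Nil
    then show ?thesis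
      by (cases b) (simp_all add: l)
  next
    case (Cons k w')
    obtain p c where k: "k = (p, c)"
      by fastforce
    have "p \<noteq> q \<or> c = b"
      using \<open>reduced_word (l # w)\<close> by (auto simp: Cons k l reduced_word_def inv_letter_def)
    then show ?thesis
      using Cons.IH[OF w] by (cases b; cases c) (auto simp: Cons k l)
  qed
qed simp

lemma word_act_aleshin_vorobets_eq_id:
  assumes "reduced_word w" "word_act aleshin_vorobets w = id"
  shows "w = []"
proof -
  have "foldr (act bellaterra) (expand w) = id"
    using assms(2) foldr_expand[of w] by (simp add: fun_eq_iff)
  then have "relator (rev (expand w))"
    by (simp add: relator_def foldr_conv_fold)
  moreover have "distinct_adj (rev (expand w))"
    using expand_reduced[OF assms(1)] by simp
  ultimately have "expand w = []"
    using not_relator[of "rev (expand w)"] by auto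
  then show ?thesis
    by (cases w rule: expand.cases) auto
qed

lemma aleshin_vorobets_iso_free_group:
  "automaton_group aleshin_vorobets \<cong> free_group {..<3 :: nat}"
proof -
  define e :: "nat \<Rightarrow> state" where "e = (\<lambda>n. if n = 0 then Sa else if n = 1 then Sb else Sc)"
  have "{..<3 :: nat} = {0, 1, 2}"
    by auto
  then have "bij_betw e {..<3} UNIV"
    by (auto simp: bij_betw_def inj_on_def e_def UNIV_eq_I[of "{Sa, Sb, Sc}"] intro: state.exhaust)
  then have "free_group {..<3 :: nat} \<cong> free_group (UNIV :: state set)"
    by (rule free_group_iso)
  also have "\<dots> \<cong> automaton_group aleshin_vorobets"
    by (rule free_group_iso_automaton_group[OF invertible_aleshin_vorobets
        word_act_aleshin_vorobets_eq_id])
  finally show ?thesis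
    by (rule group.iso_sym[OF group_free_group])
qed

lemma not_comm_free_group: "\<not> comm_group (free_group {..<3 :: nat})"
proof
  assume "comm_group (free_group {..<3 :: nat})"
  then interpret comm_group "free_group {..<3 :: nat}" .
  show False
    using m_comm[of "[(0, True)]" "[(1, True)]"] by (simp add: reduced_word_def inv_letter_def)
qed

section \<open>Classification\<close>

text \<open>A permutation of two letters is determined by the image of \<open>False\<close>, which
  is \<open>True\<close> exactly for active states.\<close>

lemma invertible_eq_aut:
  assumes "invertible_automaton (B :: (state, bool) automaton)"
  obtains C where "B = aut C"
proof -
  define t where "t q = (out B q False, transition B q False, transition B q True)" for q
  define C where "C = (t Sa, t Sb, t Sc)"
  have entry: "entry C q = t q" for q
    by (cases q) (simp_all add: C_def)
  have inj: "out B q True \<noteq> out B q False" for q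
    using assms by (metis bij_is_inj injD invertible_automaton_def)
  have "transition B q x = transition (aut C) q x" "out B q x = out (aut C) q x" for q x
    using inj[of q] by (cases x; simp add: aut_def entry t_def)+
  then have "B = aut C"
    by (intro automaton.equality) (auto simp: fun_eq_iff)
  then show thesis
    by (rule that)
qed

text \<open>The type of the basis is left open, so that this applies both to
  \<open>is_free_group\<close> and to an isomorphism with the group of rank three.\<close>

lemma free_imp_symmetric_aleshin_vorobets:
  fixes A :: "('q::finite, 'x::finite) automaton" and S :: "'z set"
  assumes card: "card (UNIV :: 'q set) = 3" "card (UNIV :: 'x set) = 2"
    and A: "invertible_automaton A"
    and free: "automaton_group A \<cong> free_group S" and nonabelian: "\<not> comm_group (automaton_group A)"
  shows "symmetric_automata A aleshin_vorobets"
proof -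
  have UNIV: "(UNIV :: state set) = {Sa, Sb, Sc}"
    using state.exhaust by blast
  have "card (UNIV :: state set) = 3"
    unfolding UNIV by simp
  then obtain f :: "'q \<Rightarrow> state" where f: "bij f"
    using finite_same_card_bij[of "UNIV :: 'q set" "UNIV :: state set"] card by auto
  obtain g :: "'x \<Rightarrow> bool" where g: "bij g"
    using finite_same_card_bij[of "UNIV :: 'x set" "UNIV :: bool set"] card by auto
  define B where "B = rename_states f (rename_letters g A)"
  have B: "invertible_automaton B" and iso: "automaton_group A \<cong> automaton_group B"
    using rename_iso[OF A f g] by (simp_all add: B_def)
  note iso' = group.iso_sym[OF group_automaton_group iso]
  have "\<not> comm_group (automaton_group B)"
    using nonabelian comm_group.iso_imp_comm_group[OF _ iso' group.is_monoid[OF group_automaton_group]]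
    by blast
  moreover have "torsion_free_CSA (automaton_group B)"
    using torsion_free_CSA_iso[OF group_automaton_group group_free_group iso_trans[OF iso' free]]
      torsion_free_CSA_free_group by blast
  moreover have "classified B"
    using invertible_eq_aut[OF B] classified_aut by metis
  ultimately show ?thesis
    using f g by (auto simp: classified_def symmetric_automata_def B_def)
qed

theorem theorem5:
  assumes "card (UNIV :: 'q::finite set) = 3" and "card (UNIV :: 'x::finite set) = 2"
  shows "automaton_group aleshin_vorobets \<cong> free_group {..<3::nat} \<and>
    (\<forall>A :: ('q, 'x) automaton.
       invertible_automaton A \<and>
       is_free_group (automaton_group A) \<and> \<not> comm_group (automaton_group A) \<longrightarrow>
         automaton_group A \<cong> free_group {..<3::nat}) \<and>
    (\<forall>A :: ('q, 'x) automaton.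
       invertible_automaton A \<longrightarrow>
         (automaton_group A \<cong> automaton_group aleshin_vorobets \<longleftrightarrow>
          symmetric_automata A aleshin_vorobets))"
proof (intro conjI allI impI iffI)
  note symmetric = free_imp_symmetric_aleshin_vorobets[OF assms]
  show "automaton_group aleshin_vorobets \<cong> free_group {..<3::nat}"
    by (rule aleshin_vorobets_iso_free_group)
  fix A :: "('q, 'x) automaton"
  show "automaton_group A \<cong> free_group {..<3::nat}"
    if "invertible_automaton A \<and>
       is_free_group (automaton_group A) \<and> \<not> comm_group (automaton_group A)"
  proof -
    have "symmetric_automata A aleshin_vorobets"
      using that symmetric unfolding is_free_group_def by blast
    then show ?thesis
      using symmetric_automata_iso that aleshin_vorobets_iso_free_group iso_trans by blast
  qed
  assume A: "invertible_automaton A"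
  show "automaton_group A \<cong> automaton_group aleshin_vorobets" if "symmetric_automata A aleshin_vorobets"
    using symmetric_automata_iso that A by blast
  show "symmetric_automata A aleshin_vorobets"
    if "automaton_group A \<cong> automaton_group aleshin_vorobets"
  proof -
    have iso: "automaton_group A \<cong> free_group {..<3::nat}"
      by (rule iso_trans[OF that aleshin_vorobets_iso_free_group])
    moreover have "\<not> comm_group (automaton_group A)"
      using not_comm_free_group
        comm_group.iso_imp_comm_group[OF _ iso group.is_monoid[OF group_free_group]] by blast
    ultimately show ?thesis
      by (rule symmetric[OF A])
  qed
qed

end
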